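(* Let $N\ge 1$ and consider an undirected, connected graph on the node set $\mathcal{N}=\{1,\dots,N\}$, where $\mathcal{N}_i\subset\mathcal{N}$ denotes the set of neighbors of node $i$. Let $\mathcal{L}$ be the Laplacian matrix of this graph and let $\lambda_2(\mathcal{L})$ be its second smallest eigenvalue (the algebraic connectivity). Let $z_1,\dots,z_N\in\mathbb{R}$ be given numbers and $s_1,\dots,s_N\in\{0,1\}$ given indicators with $s_i=1$ for at least one $i$. Consider the system $$\dot{x}_i = s_i\,\mathrm{sgn}(z_i - x_i) + \gamma \sum_{j \in \mathcal{N}_i} (x_j - x_i), \qquad i \in \mathcal{N},$$ with $x_i\in\mathbb{R}$ and a design parameter $\gamma>0$. Then for each $\gamma>0$, the (Filippov) solution from any initial condition $x_i(0)\in\mathbb{R}$, $i\in\mathcal{N}$, exists for all $t\ge 0$ and satisfies $$\limsup_{t \to \infty} \|x_i(t)\|_{\mathcal{M}_{\mathcal{Z}}^{\mathcal{S}}} \le \frac{2\sqrt{N}}{\gamma\lambda_2(\mathcal{L})}, \qquad \forall i \in \mathcal{N}.$$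
   Context: The adjacency matrix $\mathcal{A}=[\alpha_{ij}]$ of the graph has entries $\alpha_{ij}\in\{0,1\}$ ($\alpha_{ij}=1$ iff $j\in\mathcal{N}_i$), and $\mathcal{L}=\mathcal{D}-\mathcal{A}$ with $\mathcal{D}$ the diagonal matrix of row sums of $\mathcal{A}$. The function $\mathrm{sgn}:\mathbb{R}\to\mathbb{R}$ is $\mathrm{sgn}(s)=s/|s|$ for $s\neq0$ and $\mathrm{sgn}(0)=0$; solutions of this discontinuous system are understood in the sense of Filippov. Let $S:=|\{i\in\mathcal{N}: s_i=1\}|$ and let $z_1^s\le z_2^s\le\cdots\le z_S^s$ be the elements of $\{z_i : s_i=1\}$ sorted in nondecreasing order (with multiplicity). The median set is $\mathcal{M}_{\mathcal{Z}}^{\mathcal{S}}=\{z^s_{(S+1)/2}\}$ if $S$ is odd and $\mathcal{M}_{\mathcal{Z}}^{\mathcal{S}}=[z^s_{S/2}, z^s_{S/2+1}]$ if $S$ is even. For a set $\Xi$, $\|x\|_\Xi:=\inf_{y\in\Xi}\|x-y\|$ denotes the distance from $x$ to $\Xi$.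
   Formalization: The formal statement requires N ≥ 2 instead of N ≥ 1, because for N = 1 the Laplacian has only one eigenvalue, so the second smallest eigenvalue and the bound are undefined. *)

theory Defs
  imports "HOL-Analysis.Analysis" "HOL-Library.Multiset"
begin

text \<open>Absolute continuity of a vector-valued function on a compact interval
  (classical epsilon-delta definition with finitely many nonoverlapping subintervals).\<close>
definition abs_cont_on :: "real set \<Rightarrow> (real \<Rightarrow> 'a::real_normed_vector) \<Rightarrow> bool" where
  "abs_cont_on I x \<longleftrightarrow>
     (\<forall>\<epsilon>>0. \<exists>\<delta>>0. \<forall>(n::nat) (a::nat\<Rightarrow>real) (b::nat\<Rightarrow>real).
        (\<forall>k<n. a k \<le> b k \<and> a k \<in> I \<and> b k \<in> I) \<and>
        (\<forall>k<n. \<forall>l<n. k \<noteq> l \<longrightarrow> b k \<le> a l \<or> b l \<le> a k) \<and>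
        (\<Sum>k<n. b k - a k) < \<delta>
        \<longrightarrow> (\<Sum>k<n. norm (x (b k) - x (a k))) < \<epsilon>)"

text \<open>Filippov set-valued regularization of a vector field f at the point x.\<close>
definition filippov_set :: "('a::euclidean_space \<Rightarrow> 'a) \<Rightarrow> 'a \<Rightarrow> 'a set" where
  "filippov_set f x =
     (\<Inter>\<delta>\<in>{0<..}. \<Inter>S\<in>null_sets lebesgue. closure (convex hull (f ` (ball x \<delta> - S))))"

text \<open>A Filippov solution on [0,\<infinity>) starting at x0: absolutely continuous on every
  [0,T], and for almost every t \<ge> 0 differentiable with derivative in the Filippov set.\<close>
definition filippov_solution :: "('a::euclidean_space \<Rightarrow> 'a) \<Rightarrow> 'a \<Rightarrow> (real \<Rightarrow> 'a) \<Rightarrow> bool" where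
  "filippov_solution f x0 x \<longleftrightarrow>
     x 0 = x0 \<and>
     (\<forall>T\<ge>0. abs_cont_on {0..T} x) \<and>
     (AE t in lebesgue. t \<ge> 0 \<longrightarrow>
        (\<exists>d. (x has_vector_derivative d) (at t) \<and> d \<in> filippov_set f (x t)))"

text \<open>Graph notions; nodes are the elements of the finite type 'n, adjacency alpha with 0/1 entries.\<close>
definition graph_connected :: "('n \<Rightarrow> 'n \<Rightarrow> real) \<Rightarrow> bool" where
  "graph_connected \<alpha> \<longleftrightarrow> (\<forall>i j. (i, j) \<in> {(p, q). \<alpha> p q = 1}\<^sup>*)"

definition laplacian :: "('n::finite \<Rightarrow> 'n \<Rightarrow> real) \<Rightarrow> real^'n^'n" where
  "laplacian \<alpha> = (\<chi> i j. (if i = j then (\<Sum>k\<in>UNIV. \<alpha> i k) else 0) - \<alpha> i j)"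

definition is_eigenvalue :: "real^'n^'n \<Rightarrow> real \<Rightarrow> bool" where
  "is_eigenvalue M c \<longleftrightarrow> (\<exists>v. v \<noteq> 0 \<and> M *v v = c *\<^sub>R v)"

definition eigenspace :: "real^'n^'n \<Rightarrow> real \<Rightarrow> (real^'n) set" where
  "eigenspace M c = {v. M *v v = c *\<^sub>R v}"

text \<open>Second smallest eigenvalue of a symmetric matrix, counted with multiplicity
  (for symmetric matrices the multiplicity is the dimension of the eigenspace).\<close>
definition lambda2 :: "real^'n^'n \<Rightarrow> real" where
  "lambda2 M = Min {c. is_eigenvalue M c \<and>
      2 \<le> (\<Sum>\<mu>\<in>{\<mu>. is_eigenvalue M \<mu> \<and> \<mu> \<le> c}. dim (eigenspace M \<mu>))}"

text \<open>The median set of {z i | s i = 1} (lists are 0-indexed).\<close>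
definition median_set :: "('n::finite \<Rightarrow> real) \<Rightarrow> ('n \<Rightarrow> real) \<Rightarrow> real set" where
  "median_set z s =
     (let zs = sorted_list_of_multiset (image_mset z (mset_set {i. s i = 1}));
          S = length zs
      in if odd S then {zs ! ((S + 1) div 2 - 1)}
         else {zs ! (S div 2 - 1) .. zs ! (S div 2)})"

text \<open>The vector field of the system.\<close>
definition median_field ::
    "('n::finite \<Rightarrow> 'n \<Rightarrow> real) \<Rightarrow> ('n \<Rightarrow> real) \<Rightarrow> ('n \<Rightarrow> real) \<Rightarrow> real \<Rightarrow> real^'n \<Rightarrow> real^'n" where
  "median_field \<alpha> z s \<gamma> x =
     (\<chi> i. s i * sgn (z i - x $ i) + \<gamma> * (\<Sum>j\<in>{j. \<alpha> i j = 1}. x $ j - x $ i))"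

end

theory Submission
  imports Defs
begin

text \<open>Split a solution x into its mean and its disagreement e = x - mean. Along a Filippov solution
  the derivative of the norm of e is at most sqrt N - \<gamma> \<lambda>2 |e|, so eventually |e| stays below
  r + \<epsilon> with r = sqrt N / (\<gamma> \<lambda>2). If the mean exceeds the upper end of the median set by more
  than r + \<epsilon>, then every coordinate lies above that end, a strict majority of the active nodes pulls
  down, and the mean decreases at rate at least 1/N; symmetrically below. Hence every
  coordinate is eventually within 2 (r + \<epsilon>) of the median set.

  Solutions exist because the discontinuous field itself is dissipative, so its explicit Euler
  iterates converge locally uniformly.\<close>

section \<open>Absolutely continuous functions\<close>

text \<open>Solutions are merely absolutely continuous and the field jumps, so only derivative
  bounds valid almost everywhere are available. Both asymptotic estimates are therefore cast in one
  form: above some level a scalar function decreases at a fixed positive rate. This is what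
  \<epsilon> is for: at |e| = r the bound sqrt N - \<gamma> \<lambda>2 |e| is zero, and only beyond
  r + \<epsilon> is there a definite rate.

  The number sqrt N bounds the Euclidean norm of the sign part of the velocity, whose N entries lie
  in [-1, 1]. The eigenvalue \<lambda>2 enters because e is orthogonal to the constants. The factor
  2 counts r twice: once for the distance of the mean from the median set, once for the distance of
  a coordinate from the mean.

  The median is used only through counting. With S active nodes, at least S div 2 + 1 active values
  are at or below the upper end of the median set, and as many at or above its lower end, for either
  parity.

  The asymptotic bound is shown for every Filippov solution, so it relies on the differential
  inclusion alone and not on the Euler construction.\<close>

lemma abs_cont_on_family:
  assumes "abs_cont_on I f" "\<epsilon> > 0"
  shows "\<exists>\<delta>>0. \<forall>(A::'b set) l r. finite A \<and> (\<forall>k\<in>A. l k \<le> r k \<and> l k \<in> I \<and> r k \<in> I) \<and>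
       (\<forall>k\<in>A. \<forall>m\<in>A. k \<noteq> m \<longrightarrow> r k \<le> l m \<or> r m \<le> l k) \<and>
       (\<Sum>k\<in>A. r k - l k) < \<delta> \<longrightarrow> (\<Sum>k\<in>A. norm (f (r k) - f (l k))) < \<epsilon>"
proof -
  from assms(1)[unfolded abs_cont_on_def, THEN spec, THEN mp, OF assms(2)]
  obtain \<delta> where d: "\<delta> > 0" "\<forall>(n::nat) (a::nat\<Rightarrow>real) (b::nat\<Rightarrow>real).
        (\<forall>k<n. a k \<le> b k \<and> a k \<in> I \<and> b k \<in> I) \<and>
        (\<forall>k<n. \<forall>l<n. k \<noteq> l \<longrightarrow> b k \<le> a l \<or> b l \<le> a k) \<and>
        (\<Sum>k<n. b k - a k) < \<delta>
        \<longrightarrow> (\<Sum>k<n. norm (f (b k) - f (a k))) < \<epsilon>"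
    by (elim exE conjE)
  show ?thesis
  proof (intro exI[of _ \<delta>] conjI d(1) allI impI, elim conjE)
    fix A :: "'b set" and l r
    assume A: "finite A" "\<forall>k\<in>A. l k \<le> r k \<and> l k \<in> I \<and> r k \<in> I"
      "\<forall>k\<in>A. \<forall>m\<in>A. k \<noteq> m \<longrightarrow> r k \<le> l m \<or> r m \<le> l k"
      "(\<Sum>k\<in>A. r k - l k) < \<delta>"
    obtain h where h: "bij_betw h {..<card A} A"
      using ex_bij_betw_nat_finite[OF A(1)] by (auto simp: atLeast0LessThan)
    have hin: "h k \<in> A" if "k < card A" for k
      using h that by (auto simp: bij_betw_def)
    have hne: "h k \<noteq> h m" if "k < card A" "m < card A" "k \<noteq> m" for k m
      using h that by (auto simp: bij_betw_def inj_on_def)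
    have "(\<Sum>k<card A. norm (f (r (h k)) - f (l (h k)))) < \<epsilon>"
    proof (rule d(2)[THEN spec, THEN spec, THEN spec, THEN mp], intro conjI)
      show "(\<Sum>k<card A. r (h k) - l (h k)) < \<delta>"
        using A(4) sum.reindex_bij_betw[OF h, of "\<lambda>k. r k - l k"] by simp
    qed (use A hin hne in auto)
    then show "(\<Sum>k\<in>A. norm (f (r k) - f (l k))) < \<epsilon>"
      using sum.reindex_bij_betw[OF h, of "\<lambda>k. norm (f (r k) - f (l k))"] by simp
  qed
qed

lemma abs_cont_on_lipschitz_compose:
  fixes f :: "real \<Rightarrow> 'a::real_normed_vector" and g :: "'a \<Rightarrow> 'b::real_normed_vector"
  assumes ac: "abs_cont_on I f" and lip: "\<And>x y. norm (g x - g y) \<le> C * norm (x - y)"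
  shows "abs_cont_on I (\<lambda>t. g (f t))"
  unfolding abs_cont_on_def
proof (intro allI impI)
  fix \<epsilon> :: real assume "\<epsilon> > 0"
  define K where "K = \<bar>C\<bar> + 1"
  have K: "K > 0" by (simp add: K_def)
  have lip': "norm (g x - g y) \<le> K * norm (x - y)" for x y
    by (rule order_trans[OF lip]) (auto simp: K_def intro!: mult_right_mono)
  from ac[unfolded abs_cont_on_def, THEN spec, THEN mp, OF divide_pos_pos[OF \<open>\<epsilon> > 0\<close> K]]
  obtain \<delta> where d: "\<delta> > 0" "\<forall>(n::nat) (a::nat\<Rightarrow>real) (b::nat\<Rightarrow>real).
        (\<forall>k<n. a k \<le> b k \<and> a k \<in> I \<and> b k \<in> I) \<and>
        (\<forall>k<n. \<forall>l<n. k \<noteq> l \<longrightarrow> b k \<le> a l \<or> b l \<le> a k) \<and>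
        (\<Sum>k<n. b k - a k) < \<delta>
        \<longrightarrow> (\<Sum>k<n. norm (f (b k) - f (a k))) < \<epsilon> / K"
    by (elim exE conjE)
  show "\<exists>\<delta>>0. \<forall>(n::nat) (a::nat\<Rightarrow>real) (b::nat\<Rightarrow>real).
        (\<forall>k<n. a k \<le> b k \<and> a k \<in> I \<and> b k \<in> I) \<and>
        (\<forall>k<n. \<forall>l<n. k \<noteq> l \<longrightarrow> b k \<le> a l \<or> b l \<le> a k) \<and>
        (\<Sum>k<n. b k - a k) < \<delta>
        \<longrightarrow> (\<Sum>k<n. norm (g (f (b k)) - g (f (a k)))) < \<epsilon>"
  proof (intro exI[of _ \<delta>] conjI d(1) allI impI)
    fix n :: nat and a b :: "nat \<Rightarrow> real"
    assume "(\<forall>k<n. a k \<le> b k \<and> a k \<in> I \<and> b k \<in> I) \<and>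
        (\<forall>k<n. \<forall>l<n. k \<noteq> l \<longrightarrow> b k \<le> a l \<or> b l \<le> a k) \<and>
        (\<Sum>k<n. b k - a k) < \<delta>"
    from d(2)[THEN spec, THEN spec, THEN spec, THEN mp, OF this] have "K * (\<Sum>k<n. norm (f (b k) - f (a k))) < \<epsilon>"
      using K by (simp add: field_simps)
    moreover have "(\<Sum>k<n. norm (g (f (b k)) - g (f (a k)))) \<le> K * (\<Sum>k<n. norm (f (b k) - f (a k)))"
      unfolding sum_distrib_left by (intro sum_mono lip')
    ultimately show "(\<Sum>k<n. norm (g (f (b k)) - g (f (a k)))) < \<epsilon>" by linarith
  qed
qed

lemma abs_cont_on_subset:
  assumes "abs_cont_on I f" "J \<subseteq> I"
  shows "abs_cont_on J f"
  unfolding abs_cont_on_def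
proof (intro allI impI)
  fix \<epsilon> :: real assume "\<epsilon> > 0"
  from assms(1)[unfolded abs_cont_on_def, THEN spec, THEN mp, OF this]
  show "\<exists>\<delta>>0. \<forall>(n::nat) (a::nat\<Rightarrow>real) (b::nat\<Rightarrow>real).
        (\<forall>k<n. a k \<le> b k \<and> a k \<in> J \<and> b k \<in> J) \<and>
        (\<forall>k<n. \<forall>l<n. k \<noteq> l \<longrightarrow> b k \<le> a l \<or> b l \<le> a k) \<and>
        (\<Sum>k<n. b k - a k) < \<delta>
        \<longrightarrow> (\<Sum>k<n. norm (f (b k) - f (a k))) < \<epsilon>"
    using assms(2) by (elim ex_forward conj_forward all_forward imp_forward) auto
qed

lemma abs_cont_on_lipschitz:
  fixes f :: "real \<Rightarrow> 'a::real_normed_vector"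
  assumes lip: "\<And>x y. x \<in> I \<Longrightarrow> y \<in> I \<Longrightarrow> x \<le> y \<Longrightarrow> norm (f y - f x) \<le> C * (y - x)" and C: "C > 0"
  shows "abs_cont_on I f"
  unfolding abs_cont_on_def
proof (intro allI impI)
  fix \<epsilon> :: real assume "\<epsilon> > 0"
  show "\<exists>\<delta>>0. \<forall>(n::nat) (a::nat\<Rightarrow>real) (b::nat\<Rightarrow>real).
        (\<forall>k<n. a k \<le> b k \<and> a k \<in> I \<and> b k \<in> I) \<and>
        (\<forall>k<n. \<forall>l<n. k \<noteq> l \<longrightarrow> b k \<le> a l \<or> b l \<le> a k) \<and>
        (\<Sum>k<n. b k - a k) < \<delta>
        \<longrightarrow> (\<Sum>k<n. norm (f (b k) - f (a k))) < \<epsilon>"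
  proof (intro exI[of _ "\<epsilon> / C"] conjI allI impI)
    fix n :: nat and a b :: "nat \<Rightarrow> real"
    assume *: "(\<forall>k<n. a k \<le> b k \<and> a k \<in> I \<and> b k \<in> I) \<and>
        (\<forall>k<n. \<forall>l<n. k \<noteq> l \<longrightarrow> b k \<le> a l \<or> b l \<le> a k) \<and>
        (\<Sum>k<n. b k - a k) < \<epsilon> / C"
    have "(\<Sum>k<n. norm (f (b k) - f (a k))) \<le> C * (\<Sum>k<n. b k - a k)"
      unfolding sum_distrib_left by (intro sum_mono lip) (use * in auto)
    also have "\<dots> < \<epsilon>" using * C by (simp add: field_simps)
    finally show "(\<Sum>k<n. norm (f (b k) - f (a k))) < \<epsilon>" .
  qed (use \<open>\<epsilon> > 0\<close> C in simp)
qed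

lemma abs_cont_on_imp_continuous_on:
  fixes f :: "real \<Rightarrow> 'a::real_normed_vector"
  assumes "abs_cont_on I f"
  shows "continuous_on I f"
  unfolding continuous_on_iff
proof (intro ballI allI impI)
  fix t \<epsilon> :: real assume t: "t \<in> I" and "\<epsilon> > 0"
  \<comment> \<open>A family with a single interval suffices, so the index type is
    \<open>unit\<close>.\<close>
  from abs_cont_on_family[OF assms \<open>\<epsilon> > 0\<close>]
  obtain \<delta> where d: "\<delta> > 0"
    "\<forall>(A::unit set) l r. finite A \<and> (\<forall>k\<in>A. l k \<le> r k \<and> l k \<in> I \<and> r k \<in> I) \<and>
       (\<forall>k\<in>A. \<forall>m\<in>A. k \<noteq> m \<longrightarrow> r k \<le> l m \<or> r m \<le> l k) \<and>
       (\<Sum>k\<in>A. r k - l k) < \<delta> \<longrightarrow> (\<Sum>k\<in>A. norm (f (r k) - f (l k))) < \<epsilon>"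
    by (elim exE conjE)
  show "\<exists>d>0. \<forall>x'\<in>I. dist x' t < d \<longrightarrow> dist (f x') (f t) < \<epsilon>"
  proof (intro exI[of _ \<delta>] conjI d(1) ballI impI)
    fix u assume u: "u \<in> I" "dist u t < \<delta>"
    have "(\<Sum>k\<in>{()}. norm (f (max u t) - f (min u t))) < \<epsilon>"
      by (rule d(2)[THEN spec, THEN spec, THEN spec, THEN mp]) (use t u in \<open>auto simp: dist_real_def min_def max_def\<close>)
    then show "dist (f u) (f t) < \<epsilon>"
      by (auto simp: dist_norm min_def max_def norm_minus_commute split: if_splits)
  qed
qed

text \<open>Cousin's lemma replaces integration theory: tags at exceptional points only pick up
  subintervals of an open set of small measure, where absolute continuity controls the increments.\<close>
lemma abs_cont_on_growth_le:
  fixes f :: "real \<Rightarrow> real"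
  assumes ac: "abs_cont_on {a..b} f" and ab: "a \<le> b"
    and der: "AE t in lebesgue. t \<in> {a<..<b} \<longrightarrow> (\<exists>d. (f has_real_derivative d) (at t) \<and> d \<le> c)"
  shows "f b - f a \<le> c * (b - a)"
proof -
  define G where "G = {t \<in> {a<..<b}. \<exists>d. (f has_real_derivative d) (at t) \<and> d \<le> c}"
  \<comment> \<open>The endpoints also land in \<open>E\<close>; they only add a null set.\<close>
  define E where "E = {a..b} - G"
  have "negligible E"
  proof -
    have "negligible {t. \<not> (t \<in> {a<..<b} \<longrightarrow> (\<exists>d. (f has_real_derivative d) (at t) \<and> d \<le> c))}"
      using der by (simp only: AE_iff_null_sets[symmetric] eventually_ae_filter_negligible) (auto intro: negligible_subset)
    moreover have "negligible {a, b}" by simp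
    ultimately show ?thesis
      by (rule negligible_subset[OF negligible_Un]) (auto simp: E_def G_def)
  qed
  then have E0: "E \<in> sets lebesgue" "emeasure lebesgue E = 0"
    by (auto simp: negligible_iff_null_sets)
  \<comment> \<open>The slack e is spent three times: on the slope near good tags, on the increments
    over the exceptional intervals, and on their total length, which is missing from b - a in the
    slope term. The factor c + e may have either sign, hence its absolute value.\<close>
  have key: "f b - f a \<le> (c + e) * (b - a) + \<bar>c + e\<bar> * e + e" if e: "e > 0" for e
  proof -
    \<comment> \<open>The intervals are indexed by the tagged pairs themselves, which is why
      absolute continuity was restated for arbitrary finite index sets.\<close>
    from abs_cont_on_family[OF ac e]
    obtain \<delta>0 where d0: "\<delta>0 > 0"
      "\<forall>(A::(real \<times> real set) set) l r. finite A \<and> (\<forall>k\<in>A. l k \<le> r k \<and> l k \<in> {a..b} \<and> r k \<in> {a..b}) \<and>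
       (\<forall>k\<in>A. \<forall>m\<in>A. k \<noteq> m \<longrightarrow> r k \<le> l m \<or> r m \<le> l k) \<and>
       (\<Sum>k\<in>A. r k - l k) < \<delta>0 \<longrightarrow> (\<Sum>k\<in>A. norm (f (r k) - f (l k))) < e"
      by (elim exE conjE)
    define \<delta> where "\<delta> = min \<delta>0 e"
    have d: "\<delta> > 0" "\<delta> \<le> \<delta>0" "\<delta> \<le> e" using d0(1) e by (auto simp: \<delta>_def)
    obtain U where U: "open U" "E \<subseteq> U" "U - E \<in> lmeasurable" "emeasure lebesgue (U - E) < ennreal \<delta>"
      using sets_lebesgue_outer_open[OF E0(1) d(1)] by blast
    have Um: "U \<in> sets lebesgue" using U(1) by (simp add: borel_open)
    have "emeasure lebesgue U \<le> emeasure lebesgue (U - E) + emeasure lebesgue E"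
      using emeasure_subadditive[of "U - E" lebesgue E] U E0 by (simp add: Un_absorb2)
    then have "emeasure lebesgue U < ennreal \<delta>" using U E0 by simp
    then have Ul: "U \<in> lmeasurable" and Umeas: "measure lebesgue U < \<delta>"
      using Um less_trans[OF _ ennreal_less_top]
      by (auto simp: fmeasurable_def measure_def simp del: emeasure_completion)
    \<comment> \<open>A straddle estimate: the bounds to the left and to the right of t add up to a
      bound on any small interval that contains t.\<close>
    have "\<exists>r>0. \<forall>y. \<bar>y - t\<bar> < r \<longrightarrow> (y \<ge> t \<longrightarrow> f y - f t \<le> (c + e) * (y - t)) \<and> (y \<le> t \<longrightarrow> f t - f y \<le> (c + e) * (t - y))"
      if tG: "t \<in> G" for t
    proof -
      obtain D where D: "(f has_real_derivative D) (at t)" "D \<le> c" using tG unfolding G_def by blast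
      then have "(f has_derivative (\<lambda>h. D * h)) (at t)" by (simp add: has_field_derivative_def)
      then obtain r where r: "r > 0" "\<And>y. norm (y - t) < r \<Longrightarrow> norm (f y - f t - D * (y - t)) \<le> e * norm (y - t)"
        unfolding has_derivative_at_alt using e by blast
      have "(y \<ge> t \<longrightarrow> f y - f t \<le> (c + e) * (y - t)) \<and> (y \<le> t \<longrightarrow> f t - f y \<le> (c + e) * (t - y))"
        if y: "\<bar>y - t\<bar> < r" for y
      proof -
        have "\<bar>f y - f t - D * (y - t)\<bar> \<le> e * \<bar>y - t\<bar>" using r(2)[of y] y by simp
        moreover have "y \<ge> t \<Longrightarrow> D * (y - t) \<le> c * (y - t)" "y \<le> t \<Longrightarrow> D * (t - y) \<le> c * (t - y)"
          using D(2) by (auto intro!: mult_right_mono)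
        ultimately show ?thesis by (auto simp: algebra_simps abs_if split: if_splits)
      qed
      then show ?thesis using r(1) by blast
    qed
    then obtain r where r: "\<And>t. t \<in> G \<Longrightarrow> r t > 0"
      "\<And>t y. t \<in> G \<Longrightarrow> \<bar>y - t\<bar> < r t \<Longrightarrow> y \<ge> t \<Longrightarrow> f y - f t \<le> (c + e) * (y - t)"
      "\<And>t y. t \<in> G \<Longrightarrow> \<bar>y - t\<bar> < r t \<Longrightarrow> y \<le> t \<Longrightarrow> f t - f y \<le> (c + e) * (t - y)"
      by metis
    define g where "g t = (if t \<in> G then ball t (r t) else if t \<in> E then U else UNIV)" for t
    have "gauge g" unfolding gauge_def g_def using r(1) U by auto
    then obtain p where p: "p tagged_division_of {a..b}" "g fine p"
      using fine_division_exists_real by blast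
    have finp: "finite p" using p(1) by auto
    have tag: "\<exists>u v. K = {u..v} \<and> u \<le> v \<and> a \<le> u \<and> v \<le> b \<and> u \<le> t \<and> t \<le> v \<and> measure lborel K = v - u \<and> Sup K = v \<and> Inf K = u"
      if "(t, K) \<in> p" for t K
    proof -
      have "t \<in> K" "K \<subseteq> {a..b}" "\<exists>u v. K = cbox u v"
        using tagged_division_ofD[OF p(1)] that by auto
      then show ?thesis by (fastforce simp: content_real)
    qed
    \<comment> \<open>Degenerate intervals must be left out: a point inside another interval has
      empty interior, so disjoint interiors would not give the ordering of endpoints that absolute
      continuity asks for. Their increments vanish anyway.\<close>
    define P where "P = {k \<in> p. fst k \<in> E \<and> measure lborel (snd k) \<noteq> 0}"
    have finP: "finite P" using finp by (simp add: P_def)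
    have Plm: "snd k \<in> lmeasurable" if "k \<in> P" for k
    proof -
      have "\<exists>u v. snd k = cbox u v" using tag[of "fst k" "snd k"] that by (auto simp: P_def)
      then show ?thesis by force
    qed
    have Pm: "(\<Sum>k\<in>P. measure lborel (snd k)) < \<delta>"
    proof -
      have "measure lebesgue (\<Union>(snd ` P)) = (\<Sum>k\<in>P. measure lebesgue (snd k))"
      proof (rule measure_negligible_finite_Union_image[OF finP])
        show "snd k \<in> lmeasurable" if "k \<in> P" for k
          by (rule Plm) fact
        show "pairwise (\<lambda>x y. negligible (snd x \<inter> snd y)) P"
        proof (rule pairwiseI)
          fix x y assume xy: "x \<in> P" "y \<in> P" "x \<noteq> y"
          obtain t K t' K' where [simp]: "x = (t, K)" "y = (t', K')" by (cases x, cases y) auto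
          have in_p: "(t, K) \<in> p" "(t', K') \<in> p" using xy by (auto simp: P_def)
          have dis: "interior K \<inter> interior K' = {}"
            using tagged_division_ofD(5)[OF p(1) in_p] xy by auto
          obtain u v u' v' where "K = cbox u v" "K' = cbox u' v'"
            using tag[OF in_p(1)] tag[OF in_p(2)] by (metis box_real(2))
          then show "negligible (snd x \<inter> snd y)"
            using dis by (metis \<open>x = (t, K)\<close> \<open>y = (t', K')\<close> negligible_convex_interior convex_Int convex_box(1) interior_Int snd_conv)
        qed
      qed
      moreover have "\<Union>(snd ` P) \<subseteq> U"
      proof clarify
        fix y t K assume "(t, K) \<in> P" "y \<in> snd (t, K)"
        then have "(t, K) \<in> p" "t \<in> E" "y \<in> K" by (auto simp: P_def)
        then have "K \<subseteq> g t" using p(2) by (auto simp: fine_def)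
        then show "y \<in> U" using \<open>t \<in> E\<close> \<open>y \<in> K\<close> by (auto simp: g_def E_def)
      qed
      moreover have "\<Union>(snd ` P) \<in> sets lebesgue"
        using Plm by (intro sets.finite_UN finP) auto
      ultimately have "(\<Sum>k\<in>P. measure lebesgue (snd k)) \<le> measure lebesgue U"
        using measure_mono_fmeasurable[OF _ _ Ul] by metis
      moreover have "measure lebesgue (snd k) = measure lborel (snd k)" if "k \<in> P" for k
      proof -
        have "\<exists>u v. snd k = cbox u v" using tag[of "fst k" "snd k"] that by (auto simp: P_def)
        then show ?thesis by (auto simp: measure_completion)
      qed
      ultimately show ?thesis using Umeas by (simp cong: sum.cong)
    qed
    have incP: "(\<Sum>k\<in>P. norm (f (Sup (snd k)) - f (Inf (snd k)))) < e"
    proof (rule d0(2)[THEN spec, THEN spec, THEN spec, THEN mp], intro conjI ballI impI finP)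
      show "Inf (snd k) \<le> Sup (snd k)" "Inf (snd k) \<in> {a..b}" "Sup (snd k) \<in> {a..b}" if "k \<in> P" for k
        using tag[of "fst k" "snd k"] that by (auto simp: P_def)
      show "Sup (snd k) \<le> Inf (snd m) \<or> Sup (snd m) \<le> Inf (snd k)" if km: "k \<in> P" "m \<in> P" "k \<noteq> m" for k m
      proof -
        obtain t K t' K' where [simp]: "k = (t, K)" "m = (t', K')" by (cases k, cases m) auto
        have in_p: "(t, K) \<in> p" "(t', K') \<in> p" using km by (auto simp: P_def)
        obtain u v where uv: "K = {u..v}" "u \<le> v" "measure lborel K = v - u" "Sup K = v" "Inf K = u" using tag[OF in_p(1)] by blast
        obtain u' v' where uv': "K' = {u'..v'}" "u' \<le> v'" "measure lborel K' = v' - u'" "Sup K' = v'" "Inf K' = u'" using tag[OF in_p(2)] by blast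
        have "u < v" "u' < v'" using km uv uv' by (auto simp: P_def)
        moreover have "{u<..<v} \<inter> {u'<..<v'} = {}"
          using tagged_division_ofD(5)[OF p(1) in_p] km uv uv' by auto
        ultimately have "v \<le> u' \<or> v' \<le> u"
          by (metis Int_greaterThanLessThan greaterThanLessThan_empty_iff max_def min_def not_le)
        then show ?thesis using uv uv' by auto
      qed
      have "(\<Sum>k\<in>P. Sup (snd k) - Inf (snd k)) = (\<Sum>k\<in>P. measure lborel (snd k))"
        using tag by (intro sum.cong) (fastforce simp: P_def)+
      then show "(\<Sum>k\<in>P. Sup (snd k) - Inf (snd k)) < \<delta>0" using Pm d by linarith
    qed
    have zero: "f (Sup K) - f (Inf K) \<le> (c + e) * measure lborel K" if tK: "(t, K) \<in> p - P" for t K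
    proof -
      obtain u v where uv: "K = {u..v}" "u \<le> t" "t \<le> v" "a \<le> u" "v \<le> b" "measure lborel K = v - u" "Sup K = v" "Inf K = u"
        using tag[of t K] tK by blast
      show ?thesis
      proof (cases "t \<in> G")
        case True
        have "K \<subseteq> g t" using p(2) tK by (auto simp: fine_def)
        then have "{u..v} \<subseteq> ball t (r t)" using True uv by (simp add: g_def)
        moreover have "u \<in> {u..v}" "v \<in> {u..v}" using uv by auto
        ultimately have "u \<in> ball t (r t)" "v \<in> ball t (r t)" by blast+
        then have "f v - f t \<le> (c + e) * (v - t)" "f t - f u \<le> (c + e) * (t - u)"
          using r(2,3)[OF True] uv by (auto simp: dist_real_def)
        then show ?thesis using uv by (simp add: algebra_simps)
      next
        case False
        then have "t \<in> E" using uv by (auto simp: E_def)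
        then have "measure lborel K = 0" using tK by (auto simp: P_def)
        then show ?thesis using uv by auto
      qed
    qed
    have tot: "(\<Sum>k\<in>p. measure lborel (snd k)) = b - a"
      using additive_content_tagged_division[of p a b] p(1) ab by (simp add: split_def)
    have "f b - f a = (\<Sum>k\<in>p. f (Sup (snd k)) - f (Inf (snd k)))"
      using additive_tagged_division_1[OF ab p(1), of f] by (simp add: split_def)
    also have "\<dots> = (\<Sum>k\<in>P. f (Sup (snd k)) - f (Inf (snd k))) + (\<Sum>k\<in>p-P. f (Sup (snd k)) - f (Inf (snd k)))"
      using finp by (subst sum.subset_diff[of P p]) (auto simp: P_def)
    also have "(\<Sum>k\<in>P. f (Sup (snd k)) - f (Inf (snd k))) \<le> (\<Sum>k\<in>P. norm (f (Sup (snd k)) - f (Inf (snd k))))"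
      by (intro sum_mono) auto
    also have "(\<Sum>k\<in>p-P. f (Sup (snd k)) - f (Inf (snd k))) \<le> (\<Sum>k\<in>p-P. (c + e) * measure lborel (snd k))"
      using zero by (intro sum_mono) force
    also have "(\<Sum>k\<in>p-P. (c + e) * measure lborel (snd k)) = (c + e) * ((b - a) - (\<Sum>k\<in>P. measure lborel (snd k)))"
      using tot finp by (subst sum_diff) (auto simp: P_def sum_distrib_left[symmetric] right_diff_distrib)
    also have "\<dots> \<le> (c + e) * (b - a) + \<bar>c + e\<bar> * e"
    proof -
      have "0 \<le> (\<Sum>k\<in>P. measure lborel (snd k))" by (simp add: sum_nonneg)
      then have "- (c + e) * (\<Sum>k\<in>P. measure lborel (snd k)) \<le> \<bar>c + e\<bar> * e"
        using Pm d by (intro order_trans[OF mult_right_mono mult_left_mono]) auto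
      then show ?thesis by (simp add: algebra_simps)
    qed
    finally show ?thesis using incP by linarith
  qed
  have "((\<lambda>e. (c + e) * (b - a) + \<bar>c + e\<bar> * e + e) \<longlongrightarrow> (c + 0) * (b - a) + \<bar>c + 0\<bar> * 0 + 0) (at_right 0)"
    by (intro tendsto_intros)
  then have "((\<lambda>e. (c + e) * (b - a) + \<bar>c + e\<bar> * e + e) \<longlongrightarrow> c * (b - a)) (at_right 0)" by simp
  then show ?thesis
    by (rule tendsto_lowerbound)
       (auto simp: eventually_at_right_less intro!: eventually_mono[OF eventually_at_right_less[of 0]] key)
qed

text \<open>A barrier argument. While \<phi> is above c it loses at least \<eta> per unit of time,
  so it reaches c after at most (\<phi> t0 - c) / \<eta>. It cannot climb back: after the last time
  with \<phi> \<le> c it would have to decrease. Both halves rest on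
  \<open>abs_cont_on_growth_le\<close>.\<close>

lemma abs_cont_on_eventually_le:
  fixes \<phi> :: "real \<Rightarrow> real"
  assumes ac: "\<And>T. T \<ge> 0 \<Longrightarrow> abs_cont_on {0..T} \<phi>" and eta: "\<eta> > 0" and t0: "t0 \<ge> 0"
    and der: "AE t in lebesgue. t > t0 \<and> \<phi> t > c \<longrightarrow> (\<exists>d. (\<phi> has_real_derivative d) (at t) \<and> d \<le> - \<eta>)"
  shows "\<forall>\<^sub>F t in at_top. \<phi> t \<le> c"
proof -
  have decr: "\<phi> b - \<phi> a \<le> - \<eta> * (b - a)"
    if "t0 \<le> a" "a \<le> b" "\<And>t. a < t \<Longrightarrow> t < b \<Longrightarrow> \<phi> t > c" for a b
  proof (rule abs_cont_on_growth_le)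
    show "abs_cont_on {a..b} \<phi>"
      by (rule abs_cont_on_subset[OF ac[of b]]) (use that t0 in auto)
    show "AE t in lebesgue. t \<in> {a<..<b} \<longrightarrow> (\<exists>d. (\<phi> has_real_derivative d) (at t) \<and> d \<le> - \<eta>)"
      using der by eventually_elim (use that in auto)
  qed fact
  have "\<exists>t1\<ge>t0. \<phi> t1 \<le> c"
  proof (rule ccontr)
    assume "\<not> ?thesis"
    then have gt: "\<phi> t > c" if "t \<ge> t0" for t using that by force
    define b where "b = t0 + (\<phi> t0 - c) / \<eta>"
    have "b \<ge> t0" using gt[of t0] eta by (simp add: b_def)
    then have "\<phi> b - \<phi> t0 \<le> - \<eta> * (b - t0)" using decr[of t0 b] gt by simp
    also have "\<dots> = c - \<phi> t0" using eta by (simp add: b_def)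
    finally show False using gt[OF \<open>b \<ge> t0\<close>] by simp
  qed
  then obtain t1 where t1: "t1 \<ge> t0" "\<phi> t1 \<le> c" by blast
  have "\<phi> t \<le> c" if "t \<ge> t1" for t
  proof (rule ccontr)
    assume nle: "\<not> \<phi> t \<le> c"
    have "continuous_on {t1..t} \<phi>"
      by (rule continuous_on_subset[OF abs_cont_on_imp_continuous_on[OF ac[of t]]]) (use t0 t1 that in auto)
    then have "closed ({t1..t} \<inter> \<phi> -` {..c})"
      by (metis Int_commute closed_atLeastAtMost closed_atMost continuous_on_closed_vimage)
    then have "compact ({t1..t} \<inter> ({t1..t} \<inter> \<phi> -` {..c}))"
      by (intro compact_Int_closed compact_Icc)
    moreover have "t1 \<in> {t1..t} \<inter> ({t1..t} \<inter> \<phi> -` {..c})" using t1 that by auto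
    \<comment> \<open>The last time up to t at which \<phi> is at most c; it exists by
      compactness.\<close>
    ultimately obtain s where s: "s \<in> {t1..t}" "\<phi> s \<le> c" "\<And>u. u \<in> {t1..t} \<Longrightarrow> \<phi> u \<le> c \<Longrightarrow> u \<le> s"
      using compact_attains_sup[of "{t1..t} \<inter> ({t1..t} \<inter> \<phi> -` {..c})"] by fastforce
    have "\<phi> t - \<phi> s \<le> - \<eta> * (t - s)"
    proof (rule decr)
      show "\<phi> u > c" if "s < u" "u < t" for u
        using s(3)[of u] s(1) that by force
    qed (use s t1 in auto)
    moreover have "\<eta> * (t - s) \<ge> 0" using s(1) eta by simp
    ultimately show False using s(2) nle by simp
  qed
  then show ?thesis using eventually_at_top_linorder by blast
qed

section \<open>Medians and Filippov sets\<close>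

text \<open>Turns the sorted list into what the dynamics can use: an interval each of whose ends has
  a strict majority of the active values on the proper side.\<close>

lemma median_set_interval:
  fixes z s :: "'n::finite \<Rightarrow> real"
  assumes "\<exists>i. s i = 1"
  obtains lo hi where "lo \<le> hi" "median_set z s = {lo..hi}"
    "card {i. s i = 1} < 2 * card {i. s i = 1 \<and> z i \<le> hi}"
    "card {i. s i = 1} < 2 * card {i. s i = 1 \<and> lo \<le> z i}"
proof -
  define A where "A = {i. s i = 1}"
  define zs where "zs = sorted_list_of_multiset (image_mset z (mset_set A))"
  have m: "mset zs = image_mset z (mset_set A)" by (simp add: zs_def)
  have srt: "sorted zs" by (simp add: zs_def)
  have len: "length zs = card A"
    using arg_cong[OF m, of size] by simp
  have "A \<noteq> {}" using assms by (auto simp: A_def)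
  then have pos: "card A > 0" by (simp add: card_gt_0_iff)
  \<comment> \<open>Nodes and list positions are matched through multisets, since several nodes may
    share one value of z.\<close>
  have cnt: "card {i. s i = 1 \<and> P (z i)} = card {k. k < length zs \<and> P (zs ! k)}" for P
  proof -
    have "card {k. k < length zs \<and> P (zs ! k)} = size (filter_mset P (mset zs))"
      by (simp add: length_filter_conv_card[symmetric] mset_filter[symmetric] del: mset_filter)
    also have "\<dots> = size (filter_mset (\<lambda>i. P (z i)) (mset_set A))"
      by (simp add: m filter_mset_image_mset)
    also have "\<dots> = card {i \<in> A. P (z i)}" by (simp add: filter_mset_mset_set)
    finally show ?thesis by (simp add: A_def)
  qed
  have up: "k < card {i. s i = 1 \<and> z i \<le> zs ! k}" if "k < card A" for k
  proof -
    have "{..k} \<subseteq> {j. j < length zs \<and> zs ! j \<le> zs ! k}"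
      using that srt len by (auto intro: sorted_nth_mono)
    from card_mono[OF _ this] show ?thesis using cnt[of "\<lambda>y. y \<le> zs ! k"] by simp
  qed
  have dn: "card A - k \<le> card {i. s i = 1 \<and> zs ! k \<le> z i}" if "k < card A" for k
  proof -
    have "{k..<card A} \<subseteq> {j. j < length zs \<and> zs ! k \<le> zs ! j}"
      using that srt len by (auto intro: sorted_nth_mono)
    from card_mono[OF _ this] show ?thesis using cnt[of "\<lambda>y. zs ! k \<le> y"] by simp
  qed
  \<comment> \<open>Positions count from 0. For S = \<open>card A\<close>, position S div 2 holds
    the middle value if S is odd and the upper middle value if S is even; position (S + 1) div 2 - 1
    holds the same middle value or the lower one. The positions up to \<open>hi\<close> number S div
    2 + 1, which is more than half of S.\<close>
  define hi where "hi = zs ! (card A div 2)"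
  define lo where "lo = zs ! ((card A + 1) div 2 - 1)"
  have "lo \<le> hi" unfolding lo_def hi_def using srt len pos by (intro sorted_nth_mono) auto
  moreover have "median_set z s = {lo..hi}"
  proof (cases "odd (card A)")
    case True
    then have "(card A + 1) div 2 - 1 = card A div 2" by (auto elim!: oddE)
    then show ?thesis using True unfolding median_set_def Let_def A_def[symmetric] zs_def[symmetric] len
      by (simp add: lo_def hi_def)
  next
    case False
    then show ?thesis unfolding median_set_def Let_def A_def[symmetric] zs_def[symmetric] len
      by (simp add: lo_def hi_def)
  qed
  moreover have "card A < 2 * card {i. s i = 1 \<and> z i \<le> hi}"
    using up[of "card A div 2"] pos unfolding hi_def by linarith
  moreover have "card A < 2 * card {i. s i = 1 \<and> lo \<le> z i}"
    using dn[of "(card A + 1) div 2 - 1"] pos unfolding lo_def by linarith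
  ultimately show ?thesis using that by (simp add: A_def)
qed

text \<open>The sum is at most \<open>card A - 2 * card L\<close>, a negative integer, hence at most
  -1. This integrality gives the mean its uniform drift 1/N.\<close>

lemma sum_majority_le:
  fixes w :: "'n \<Rightarrow> real"
  assumes "finite A" "L \<subseteq> A" "card A < 2 * card L"
    and "\<And>i. i \<in> A \<Longrightarrow> w i \<le> 1" "\<And>i. i \<in> L \<Longrightarrow> w i = -1"
  shows "sum w A \<le> -1"
proof -
  have split: "sum w A = sum w (A - L) + sum w L" by (rule sum.subset_diff) fact+
  have L: "sum w L = - real (card L)" using assms(5) by simp
  have "sum w (A - L) \<le> real (card (A - L)) * 1"
    by (rule sum_bounded_above) (use assms(4) in auto)
  moreover have "real (card (A - L)) = real (card A) - real (card L)"
    using card_mono[OF assms(1,2)] finite_subset[OF assms(2,1)] by (simp add: card_Diff_subset assms(2))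
  ultimately show ?thesis using split L assms(3) by linarith
qed

text \<open>A half-space is closed and convex, so a bound on f in a ball passes to the closed convex
  hull of its values there. The bound holds at every nearby point, so the exceptional set can be
  taken empty.\<close>

lemma filippov_set_inner_le:
  fixes f :: "'a::euclidean_space \<Rightarrow> 'a"
  assumes d: "d \<in> filippov_set f x" and ev: "\<And>e. e > 0 \<Longrightarrow> \<forall>\<^sub>F y in nhds x. a \<bullet> f y \<le> c + e"
  shows "a \<bullet> d \<le> c"
proof (rule field_le_epsilon)
  fix e :: real assume "e > 0"
  from ev[OF this] obtain \<delta> where \<delta>: "\<delta> > 0" "\<And>y. dist y x < \<delta> \<Longrightarrow> a \<bullet> f y \<le> c + e"
    unfolding eventually_nhds_metric by blast
  have "d \<in> closure (convex hull (f ` (ball x \<delta> - {})))"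
    using d \<delta>(1) unfolding filippov_set_def by blast
  also have "\<dots> \<subseteq> {y. a \<bullet> y \<le> c + e}"
    by (intro closure_minimal hull_minimal closed_halfspace_le convex_halfspace_le)
       (use \<delta>(2) in \<open>auto simp: dist_commute\<close>)
  finally show "a \<bullet> d \<le> c + e" by simp
qed

text \<open>Here \<open>w\<close> is what remains of the velocity after removing the coupling. The
  coupling is continuous and contributes its value at x in the limit. The sign term is locally
  constant off z i = x i, which pins \<open>w\<close> down there; on the switching surface only the
  bound by s i survives. Testing with \<open>axis i 1\<close> and its negative gives the two
  inequalities.\<close>

lemma filippov_set_median_field:
  assumes d: "d \<in> filippov_set (median_field \<alpha> z s \<gamma>) x" and s01: "\<And>i. s i \<in> {0, 1}"
  defines "w \<equiv> \<lambda>i. d $ i - \<gamma> * (\<Sum>j\<in>{j. \<alpha> i j = 1}. x $ j - x $ i)"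
  shows "\<bar>w i\<bar> \<le> s i" "z i < x $ i \<Longrightarrow> w i = - s i" "x $ i < z i \<Longrightarrow> w i = s i"
proof -
  define g where "g y = \<gamma> * (\<Sum>j\<in>{j. \<alpha> i j = 1}. y $ j - y $ i)" for y :: "real^'a"
  have f: "median_field \<alpha> z s \<gamma> y $ i = s i * sgn (z i - y $ i) + g y" for y
    by (simp add: median_field_def g_def)
  have w: "w i = d $ i - g x" by (simp add: w_def g_def)
  have s: "s i \<ge> 0" using s01[of i] by auto
  have "continuous_on UNIV g" unfolding g_def by (intro continuous_intros)
  then have "(g \<longlongrightarrow> g x) (nhds x)"
    by (simp add: continuous_on_eq_continuous_at isCont_def tendsto_at_iff_tendsto_nhds[symmetric])
  then have g_near: "\<forall>\<^sub>F y in nhds x. dist (g y) (g x) < e" if "e > 0" for e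
    using that by (rule tendstoD)
  have coord: "((\<lambda>y. y $ i) \<longlongrightarrow> x $ i) (nhds x)"
    by (intro tendsto_intros filterlim_ident)
  have le: "w i \<le> b" if "\<forall>\<^sub>F y in nhds x. s i * sgn (z i - y $ i) \<le> b" for b
  proof -
    have "axis i 1 \<bullet> d \<le> b + g x"
    proof (rule filippov_set_inner_le[OF d])
      show "\<forall>\<^sub>F y in nhds x. axis i 1 \<bullet> median_field \<alpha> z s \<gamma> y \<le> b + g x + e" if "e > 0" for e
        using g_near[OF that] \<open>\<forall>\<^sub>F y in nhds x. s i * sgn (z i - y $ i) \<le> b\<close>
        by eventually_elim (simp add: inner_axis' f dist_real_def)
    qed
    then show ?thesis by (simp add: inner_axis' w)
  qed
  have ge: "b \<le> w i" if "\<forall>\<^sub>F y in nhds x. b \<le> s i * sgn (z i - y $ i)" for b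
  proof -
    have "(- axis i 1) \<bullet> d \<le> - b - g x"
    proof (rule filippov_set_inner_le[OF d])
      show "\<forall>\<^sub>F y in nhds x. (- axis i 1) \<bullet> median_field \<alpha> z s \<gamma> y \<le> - b - g x + e" if "e > 0" for e
        using g_near[OF that] \<open>\<forall>\<^sub>F y in nhds x. b \<le> s i * sgn (z i - y $ i)\<close>
        by eventually_elim (simp add: inner_axis' f dist_real_def)
    qed
    then show ?thesis by (simp add: inner_axis' w)
  qed
  have sg: "- s i \<le> s i * sgn (z i - y $ i)" "s i * sgn (z i - y $ i) \<le> s i" for y :: "real^'a"
    using s by (auto simp: sgn_real_def)
  show *: "\<bar>w i\<bar> \<le> s i" using le[of "s i"] ge[of "- s i"] sg by (simp add: abs_le_iff)
  show "w i = - s i" if "z i < x $ i"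
  proof -
    have "\<forall>\<^sub>F y in nhds x. z i < y $ i" using order_tendstoD(1)[OF coord that] .
    then have "w i \<le> - s i" by (intro le, elim eventually_mono) (simp add: sgn_real_def)
    then show ?thesis using * by linarith
  qed
  show "w i = s i" if "x $ i < z i"
  proof -
    have "\<forall>\<^sub>F y in nhds x. y $ i < z i" using order_tendstoD(2)[OF coord that] .
    then have "s i \<le> w i" by (intro ge, elim eventually_mono) (simp add: sgn_real_def)
    then show ?thesis using * by linarith
  qed
qed

section \<open>The Laplacian of a connected graph\<close>

lemma laplacian_mult:
  "(laplacian \<alpha> *v x) $ i = (\<Sum>j\<in>UNIV. \<alpha> i j * (x $ i - x $ j))"
  by (simp add: laplacian_def matrix_vector_mult_def left_diff_distrib right_diff_distrib sum_subtractf
      if_distrib[of "\<lambda>u. u * _"] sum.delta sum_distrib_right cong: if_cong)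

lemma laplacian_self_adjoint:
  assumes "\<And>i j. \<alpha> i j = \<alpha> j i"
  shows "x \<bullet> (laplacian \<alpha> *v y) = (laplacian \<alpha> *v x) \<bullet> y"
proof -
  have "transpose (laplacian \<alpha>) = laplacian \<alpha>"
    unfolding transpose_def laplacian_def using assms by (auto simp: vec_eq_iff)
  then show ?thesis by (metis dot_lmul_matrix transpose_matrix_vector)
qed

lemma laplacian_const: "laplacian \<alpha> *v (\<chi> i. c) = 0"
  by (simp add: vec_eq_iff laplacian_mult)

text \<open>Obtained by averaging the form with its copy under exchange of i and j. The factor 2
  appears because each edge is counted in both orders.\<close>

lemma laplacian_quadratic_form:
  assumes sym: "\<And>i j. \<alpha> i j = \<alpha> j i"
  shows "2 * (x \<bullet> (laplacian \<alpha> *v x)) = (\<Sum>i\<in>UNIV. \<Sum>j\<in>UNIV. \<alpha> i j * (x $ i - x $ j)\<^sup>2)"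
proof -
  let ?Q = "\<Sum>i\<in>UNIV. \<Sum>j\<in>UNIV. \<alpha> i j * (x $ i * (x $ i - x $ j))"
  have Q: "x \<bullet> (laplacian \<alpha> *v x) = ?Q"
    by (simp add: inner_vec_def laplacian_mult sum_distrib_left mult.left_commute)
  have "?Q = (\<Sum>i\<in>UNIV. \<Sum>j\<in>UNIV. \<alpha> i j * (x $ j * (x $ j - x $ i)))"
    by (subst sum.swap) (simp add: sym[of _ _])
  then have "2 * ?Q = (\<Sum>i\<in>UNIV. \<Sum>j\<in>UNIV. \<alpha> i j * (x $ i * (x $ i - x $ j)) + \<alpha> i j * (x $ j * (x $ j - x $ i)))"
    by (simp add: sum.distrib)
  also have "\<dots> = (\<Sum>i\<in>UNIV. \<Sum>j\<in>UNIV. \<alpha> i j * (x $ i - x $ j)\<^sup>2)"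
    by (intro sum.cong refl) (simp add: power2_eq_square algebra_simps)
  finally show ?thesis by (simp add: Q)
qed

text \<open>Nonpositive energy forces every edge term of the quadratic form to vanish, so x agrees
  across edges and, by connectedness, along every path.\<close>

lemma laplacian_kernel:
  assumes adj01: "\<And>i j. \<alpha> i j \<in> {0, 1::real}" and sym: "\<And>i j. \<alpha> i j = \<alpha> j i"
    and conn: "graph_connected \<alpha>" and 0: "x \<bullet> (laplacian \<alpha> *v x) \<le> 0"
  shows "x $ i = x $ j"
proof -
  have nn: "\<alpha> i j * (x $ i - x $ j)\<^sup>2 \<ge> 0" for i j using adj01[of i j] by auto
  have "(\<Sum>i\<in>UNIV. \<Sum>j\<in>UNIV. \<alpha> i j * (x $ i - x $ j)\<^sup>2) \<le> 0"
    using laplacian_quadratic_form[of \<alpha> x, OF sym] 0 by simp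
  then have "(\<Sum>i\<in>UNIV. \<Sum>j\<in>UNIV. \<alpha> i j * (x $ i - x $ j)\<^sup>2) = 0"
    using nn by (intro antisym sum_nonneg) auto
  then have "\<alpha> i j * (x $ i - x $ j)\<^sup>2 = 0" for i j
    using nn by (simp add: sum_nonneg_eq_0_iff sum_nonneg)
  then have edge: "x $ i = x $ j" if "\<alpha> i j = 1" for i j
    using that by (metis mult_1 power_eq_0_iff right_minus_eq)
  have "(i, j) \<in> {(p, q). \<alpha> p q = 1}\<^sup>*" using conn by (simp add: graph_connected_def)
  then show ?thesis by induction (use edge in auto)
qed

text \<open>Eigenvectors for distinct eigenvalues are orthogonal, hence independent. Finiteness is
  what gives the \<open>Min\<close> in \<open>lambda2\<close> its meaning.\<close>

lemma finite_eigenvalues: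
  assumes sa: "\<And>x y. x \<bullet> (M *v y) = (M *v x) \<bullet> (y :: real^'n::finite)"
  shows "finite {c. is_eigenvalue M c}"
proof -
  obtain v where v: "\<And>c. is_eigenvalue M c \<Longrightarrow> v c \<noteq> 0 \<and> M *v v c = c *\<^sub>R v c"
    using choice[of "\<lambda>c v. is_eigenvalue M c \<longrightarrow> v \<noteq> 0 \<and> M *v v = c *\<^sub>R v"] unfolding is_eigenvalue_def by blast
  have orth: "v c \<bullet> v d = 0" if "is_eigenvalue M c" "is_eigenvalue M d" "c \<noteq> d" for c d
  proof -
    have "d * (v c \<bullet> v d) = c * (v c \<bullet> v d)"
      using sa[of "v c" "v d"] v[OF that(1)] v[OF that(2)] by simp
    then show ?thesis using that(3) by simp
  qed
  have inj: "inj_on v {c. is_eigenvalue M c}"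
    by (rule inj_onI) (metis orth v inner_eq_zero_iff mem_Collect_eq)
  have "independent (v ` {c. is_eigenvalue M c})"
    by (rule pairwise_orthogonal_independent)
       (auto simp: pairwise_def orthogonal_def v intro: orth dest: v)
  then have "finite (v ` {c. is_eigenvalue M c})" by (rule independent_imp_finite)
  then show ?thesis using inj finite_imageD by blast
qed

text \<open>Instead of diagonalising, minimise the quadratic form over unit vectors orthogonal to
  the constants. The minimum \<mu> is positive by connectedness and is an eigenvalue by the first
  variation. Every nonzero eigenvalue has eigenvectors orthogonal to the constants, so it is at
  least \<mu>. The kernel has dimension one, so the multiplicity count in \<open>lambda2\<close>
  first reaches 2 at \<mu>.\<close>

lemma lambda2_laplacian:
  fixes \<alpha> :: "'n::finite \<Rightarrow> 'n \<Rightarrow> real"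
  assumes N2: "CARD('n) \<ge> 2"
    and adj01: "\<And>i j. \<alpha> i j \<in> {0, 1}" and sym: "\<And>i j. \<alpha> i j = \<alpha> j i"
    and conn: "graph_connected \<alpha>"
  shows "lambda2 (laplacian \<alpha>) > 0"
    and "(\<Sum>i\<in>UNIV. x $ i) = 0 \<Longrightarrow> lambda2 (laplacian \<alpha>) * (x \<bullet> x) \<le> x \<bullet> (laplacian \<alpha> *v x)"
proof -
  define L where "L = laplacian \<alpha>"
  define q where "q x = x \<bullet> (L *v x)" for x
  define u :: "real^'n" where "u = (\<chi> i. 1)"
  have sa: "x \<bullet> (L *v y) = (L *v x) \<bullet> y" for x y
    unfolding L_def by (rule laplacian_self_adjoint[OF sym])
  have Lu: "L *v u = 0" by (simp add: L_def u_def laplacian_const)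
  have u_inner: "u \<bullet> x = (\<Sum>i\<in>UNIV. x $ i)" for x by (simp add: u_def inner_vec_def)
  have u0: "u \<noteq> 0" by (simp add: u_def vec_eq_iff)
  have q_kernel: "x = (x $ i) *\<^sub>R u" if "q x \<le> 0" for x i
    using laplacian_kernel[OF adj01 sym conn that[unfolded q_def L_def], of _ i] by (simp add: vec_eq_iff u_def)
  have uLx: "u \<bullet> (L *v x) = 0" for x by (simp add: sa Lu)
  define K where "K = sphere 0 1 \<inter> {x. u \<bullet> x = 0}"
  have "compact K" unfolding K_def by (intro compact_Int_closed compact_sphere closed_hyperplane)
  \<comment> \<open>Two distinct nodes are required for a nonzero vector orthogonal to the
    constants.\<close>
  moreover have "K \<noteq> {}"
  proof -
    obtain i j :: 'n where "i \<noteq> j"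
      using N2 by (metis card_2_iff' card_le_Suc0_iff_eq finite numeral_2_eq_2 not_less_eq_eq UNIV_I)
    define y :: "real^'n" where "y = axis i 1 - axis j 1"
    have "y $ i = 1" using \<open>i \<noteq> j\<close> by (simp add: y_def axis_def)
    then have "y \<noteq> 0" by (metis zero_index zero_neq_one)
    moreover have "u \<bullet> y = 0" by (simp add: y_def inner_diff_right inner_axis u_def)
    ultimately have "(1 / norm y) *\<^sub>R y \<in> K" by (simp add: K_def)
    then show ?thesis by blast
  qed
  moreover have "continuous_on K q"
    unfolding q_def by (intro continuous_intros matrix_vector_mult_linear_continuous_on)
  ultimately obtain v where v: "v \<in> K" "\<And>x. x \<in> K \<Longrightarrow> q v \<le> q x"
    using continuous_attains_inf by metis
  have v1: "v \<bullet> v = 1" and uv: "u \<bullet> v = 0" using v(1) by (auto simp: K_def norm_eq_sqrt_inner)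
  have v0: "v \<noteq> 0" using v1 by auto
  define \<mu> where "\<mu> = q v"
  have min: "\<mu> * (x \<bullet> x) \<le> q x" if "u \<bullet> x = 0" for x
  proof (cases "x = 0")
    case False
    have "(1 / norm x) *\<^sub>R x \<in> K" using False that by (simp add: K_def)
    from v(2)[OF this] have "\<mu> \<le> q x / (norm x)\<^sup>2"
      by (simp add: \<mu>_def q_def matrix_vector_mult_scaleR power2_eq_square)
    then show ?thesis using False by (simp add: field_simps power2_norm_eq_inner)
  qed (simp add: q_def)
  have pos: "\<mu> > 0"
  proof (rule ccontr)
    assume "\<not> ?thesis"
    then have eq: "v = (v $ i) *\<^sub>R u" for i using q_kernel[of v] by (simp add: \<mu>_def)
    \<comment> \<open>Here \<open>undefined\<close> is just some node; any coordinate would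
      do.\<close>
    have "v $ undefined * (u \<bullet> u) = 0" using uv eq[of undefined] by (metis inner_scaleR_right)
    then show False using u0 v0 eq[of undefined] by auto
  qed
  have eig: "L *v v = \<mu> *\<^sub>R v"
  proof -
    \<comment> \<open>The minimiser is varied in the direction of its own residual, which is again
      orthogonal to the constants and hence admissible.\<close>
    define r where "r = L *v v - \<mu> *\<^sub>R v"
    define k where "k = q r - \<mu> * (r \<bullet> r)"
    have ur: "u \<bullet> r = 0" by (simp add: r_def inner_diff_right uLx uv)
    have ge: "0 \<le> t * (2 * (r \<bullet> r) + t * k)" for t
    proof -
      have "u \<bullet> (v + t *\<^sub>R r) = 0" by (simp add: inner_add_right uv ur)
      from min[OF this] have "0 \<le> q (v + t *\<^sub>R r) - \<mu> * ((v + t *\<^sub>R r) \<bullet> (v + t *\<^sub>R r))" by simp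
      also have "q (v + t *\<^sub>R r) = q v + 2 * t * (r \<bullet> (L *v v)) + t\<^sup>2 * q r"
        unfolding q_def using sa[of v r]
        by (simp add: matrix_vector_right_distrib matrix_vector_mult_scaleR inner_add_left inner_add_right
            inner_commute power2_eq_square algebra_simps)
      also have "(v + t *\<^sub>R r) \<bullet> (v + t *\<^sub>R r) = 1 + 2 * t * (r \<bullet> v) + t\<^sup>2 * (r \<bullet> r)"
        by (simp add: inner_add_left inner_add_right v1 inner_commute power2_eq_square algebra_simps)
      also have "q v + 2 * t * (r \<bullet> (L *v v)) + t\<^sup>2 * q r - \<mu> * (1 + 2 * t * (r \<bullet> v) + t\<^sup>2 * (r \<bullet> r))
          = t * (2 * (r \<bullet> r) + t * k)"
      proof -
        have "r \<bullet> r = r \<bullet> (L *v v) - \<mu> * (r \<bullet> v)" by (subst (2) r_def) (simp add: inner_diff_right)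
        then have "r \<bullet> (L *v v) = r \<bullet> r + \<mu> * (r \<bullet> v)" by simp
        then show ?thesis by (simp add: \<mu>_def[symmetric] k_def power2_eq_square algebra_simps)
      qed
      finally show ?thesis .
    qed
    have "r \<bullet> r = 0"
    proof (rule ccontr)
      assume "r \<bullet> r \<noteq> 0"
      then have R: "r \<bullet> r > 0" by simp
      \<comment> \<open>Small enough that t * k cannot outweigh r \<bullet> r, and negative, so the
        product in \<open>ge\<close> would be negative.\<close>
      define t where "t = - (r \<bullet> r) / (\<bar>k\<bar> + 1)"
      have t: "t < 0" using R by (simp add: t_def divide_less_0_iff)
      have "\<bar>t * k\<bar> \<le> r \<bullet> r"
        using R by (simp add: t_def abs_mult field_simps)
      then have "2 * (r \<bullet> r) + t * k > 0" using R by linarith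
      then show False using ge[of t] t by (simp add: zero_le_mult_iff)
    qed
    then show ?thesis by (simp add: r_def)
  qed
  have ev: "c = 0 \<or> \<mu> \<le> c" if c: "is_eigenvalue L c" for c
  proof (cases "c = 0")
    case False
    obtain w where w: "w \<noteq> 0" "L *v w = c *\<^sub>R w" using c by (auto simp: is_eigenvalue_def)
    have "u \<bullet> w = 0" using uLx[of w] w False by simp
    from min[OF this] have "\<mu> * (w \<bullet> w) \<le> c * (w \<bullet> w)" by (simp add: q_def w)
    then show ?thesis using w(1) by simp
  qed simp
  have ev0: "is_eigenvalue L 0" using Lu u0 by (auto simp: is_eigenvalue_def)
  have ev\<mu>: "is_eigenvalue L \<mu>" using eig v0 by (auto simp: is_eigenvalue_def)
  have dim0: "dim (eigenspace L 0) = 1"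
  proof -
    have "eigenspace L 0 = span {u}"
    proof (intro subset_antisym subsetI)
      fix x assume "x \<in> eigenspace L 0"
      then have "q x \<le> 0" by (simp add: eigenspace_def q_def)
      from q_kernel[OF this] show "x \<in> span {u}" by (metis span_mul span_base singletonI)
    next
      fix x assume "x \<in> span {u}"
      then obtain c where "x = c *\<^sub>R u" by (auto simp: span_singleton)
      then show "x \<in> eigenspace L 0" by (simp add: eigenspace_def matrix_vector_mult_scaleR Lu)
    qed
    then show ?thesis using u0 by (simp add: dim_span dim_singleton)
  qed
  have dim\<mu>: "dim (eigenspace L \<mu>) \<ge> 1"
  proof -
    have "v \<in> eigenspace L \<mu>" by (simp add: eigenspace_def eig)
    then have "dim (eigenspace L \<mu>) \<noteq> 0" using v0 dim_eq_0[of "eigenspace L \<mu>"] by blast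
    then show ?thesis by linarith
  qed
  have "lambda2 L = \<mu>"
    unfolding lambda2_def
  proof (rule Min_eqI)
    show "finite {c. is_eigenvalue L c \<and> 2 \<le> (\<Sum>\<mu>\<in>{\<mu>. is_eigenvalue L \<mu> \<and> \<mu> \<le> c}. dim (eigenspace L \<mu>))}"
      by (rule finite_subset[OF _ finite_eigenvalues[OF sa]]) auto
    show "\<mu> \<in> {c. is_eigenvalue L c \<and> 2 \<le> (\<Sum>\<mu>\<in>{\<mu>. is_eigenvalue L \<mu> \<and> \<mu> \<le> c}. dim (eigenspace L \<mu>))}"
    proof -
      have "{c. is_eigenvalue L c \<and> c \<le> \<mu>} = {0, \<mu>}" using ev ev0 ev\<mu> pos by force
      then show ?thesis using ev\<mu> pos dim0 dim\<mu> by simp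
    qed
    show "\<mu> \<le> c" if c: "c \<in> {c. is_eigenvalue L c \<and> 2 \<le> (\<Sum>\<mu>\<in>{\<mu>. is_eigenvalue L \<mu> \<and> \<mu> \<le> c}. dim (eigenspace L \<mu>))}" for c
    proof (rule ccontr)
      assume "\<not> \<mu> \<le> c"
      then have "c = 0" using c ev by auto
      moreover have "{d. is_eigenvalue L d \<and> d \<le> 0} = {0}" using ev ev0 pos by force
      ultimately show False using c dim0 by simp
    qed
  qed
  then show "lambda2 (laplacian \<alpha>) > 0"
    and "(\<Sum>i\<in>UNIV. x $ i) = 0 \<Longrightarrow> lambda2 (laplacian \<alpha>) * (x \<bullet> x) \<le> x \<bullet> (laplacian \<alpha> *v x)"
    using pos min[of x] by (simp_all add: L_def q_def u_inner)
qed

section \<open>Existence of Filippov solutions of dissipative systems\<close>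

text \<open>Adding a linear function makes g a bi-Lipschitz homeomorphism h; its Lebesgue--Stieltjes measure
  is the push-forward of Lebesgue measure under the inverse of h, so absolute continuity
  with respect to Lebesgue measure is preservation of null sets by Lipschitz maps.\<close>
lemma lipschitz_AE_differentiable:
  fixes g :: "real \<Rightarrow> real"
  assumes lip: "\<And>x y. \<bar>g x - g y\<bar> \<le> L * \<bar>x - y\<bar>"
  shows "AE t in lebesgue. \<exists>d. (g has_real_derivative d) (at t)"
proof -
  have L: "L \<ge> 0" using lip[of 0 1] by simp
  \<comment> \<open>With the coefficient L + 1 all slopes of \<open>h\<close> lie between 1 and 2 L
    + 1.\<close>
  define h where "h t = g t + (L + 1) * t" for t
  have h_lo: "y - x \<le> h y - h x" if "x \<le> y" for x y
    using lip[of y x] that by (simp add: h_def algebra_simps abs_le_iff)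
  have h_lip: "\<bar>h y - h x\<bar> \<le> (2 * L + 1) * \<bar>y - x\<bar>" for x y
  proof -
    have "\<bar>h y - h x\<bar> \<le> \<bar>g y - g x\<bar> + \<bar>(L + 1) * (y - x)\<bar>" unfolding h_def by (simp add: algebra_simps)
    also have "\<dots> \<le> L * \<bar>y - x\<bar> + (L + 1) * \<bar>y - x\<bar>" using lip[of y x] L by (simp add: abs_mult)
    finally show ?thesis by (simp add: algebra_simps)
  qed
  have smono: "strict_mono h"
  proof (rule strict_monoI)
    show "h x < h y" if "x < y" for x y using h_lo[of x y] that by simp
  qed
  have cont: "continuous_on UNIV h"
  proof (rule continuous_on_subset[OF lipschitz_on_continuous_on[of "2 * L + 1" UNIV]])
    show "(2 * L + 1)-lipschitz_on UNIV h"
      by (rule lipschitz_onI) (use h_lip L in \<open>auto simp: dist_real_def\<close>)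
  qed auto
  have surj: "surj h"
  proof (rule surjI)
    fix y
    have lo: "h (- \<bar>y - h 0\<bar>) \<le> y" using h_lo[of "- \<bar>y - h 0\<bar>" 0] by linarith
    have hi: "y \<le> h \<bar>y - h 0\<bar>" using h_lo[of 0 "\<bar>y - h 0\<bar>"] by linarith
    have "\<exists>x. h x = y"
      using IVT'[of h "- \<bar>y - h 0\<bar>" y "\<bar>y - h 0\<bar>", OF lo hi] continuous_on_subset[OF cont] by auto
    then show "h (SOME x. h x = y) = y" by (rule someI_ex)
  qed
  have bij: "bij h" using smono surj by (simp add: bij_def strict_mono_imp_inj_on)
  define k where "k = inv h"
  have hk: "h (k y) = y" and kh: "k (h x) = x" for x y
    using bij by (auto simp: k_def bij_is_surj surj_f_inv_f bij_is_inj)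
  have h_le: "h x \<le> h y \<longleftrightarrow> x \<le> y" for x y using smono by (simp add: strict_mono_less_eq)
  have "mono k" by (rule monoI) (metis h_le hk)
  then have km[measurable]: "k \<in> borel_measurable borel" by (rule borel_measurable_mono)
  define N where "N = distr lborel borel k"
  have N_Icc: "emeasure N {a..b} = ennreal (h b - h a)" if "a \<le> b" for a b
  proof -
    have "k -` {a..b} = {h a..h b}" using h_le hk by (auto simp: vimage_def) (metis h_le hk)+
    then show ?thesis using that h_le by (simp add: N_def emeasure_distr)
  qed
  have "absolutely_continuous lborel N"
    unfolding absolutely_continuous_def
  proof
    fix A :: "real set" assume A: "A \<in> null_sets lborel"
    then have Am: "A \<in> sets borel" by auto
    have "negligible A" using A by (simp add: negligible_iff_null_sets null_sets_completionI)
    then have "negligible (h ` A)"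
    proof (rule negligible_locally_Lipschitz_image[rotated])
      show "\<exists>T B. open T \<and> x \<in> T \<and> (\<forall>y\<in>A \<inter> T. norm (h y - h x) \<le> B * norm (y - x))" for x
        using h_lip by (intro exI[of _ UNIV] exI[of _ "2 * L + 1"]) auto
    qed simp
    moreover have "h ` A = k -` A" by (auto simp: kh) (metis hk imageI)
    moreover have "k -` A \<in> sets borel" using measurable_sets[OF km Am] by simp
    ultimately have "emeasure lborel (k -` A) = 0"
      using null_sets_completion_iff[of "k -` A" lborel] by (simp add: negligible_iff_null_sets null_setsD1)
    then show "A \<in> null_sets N" using Am by (simp add: N_def null_sets_def emeasure_distr)
  qed
  then obtain f where f: "f \<in> borel_measurable lborel" "density lborel f = N"
    using sigma_finite_measure.Radon_Nikodym[OF sigma_finite_lborel, of N] by (auto simp: N_def)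
  then have fm[measurable]: "f \<in> borel_measurable borel" by simp
  define v where "v x = enn2real (f x)" for x
  have vm[measurable]: "v \<in> borel_measurable borel" unfolding v_def by measurable
  have vint: "(v has_integral (h b - h a)) {a..b}" if ab: "a \<le> b" for a b
  proof -
    have F: "(\<integral>\<^sup>+x. f x * indicator {a..b} x \<partial>lborel) = ennreal (h b - h a)"
      using N_Icc[OF ab] emeasure_density[OF f(1), of "{a..b}"] f(2) by simp
    \<comment> \<open>The integral of the density over {a..b} is finite, so the density is infinite
      only on a null set there and may be replaced by the real-valued \<open>v\<close>.\<close>
    then have "AE x in lborel. f x * indicator {a..b} x \<noteq> \<infinity>"
      by (intro nn_integral_PInf_AE) auto
    then have "AE x in lborel. ennreal (v x * indicator {a..b} x) = f x * indicator {a..b} x"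
    proof eventually_elim
      case (elim x)
      then show ?case by (cases "x \<in> {a..b}") (auto simp: v_def less_top)
    qed
    then have "(\<integral>\<^sup>+x. ennreal (v x * indicator {a..b} x) \<partial>lborel) = ennreal (h b - h a)"
      unfolding F[symmetric] by (rule nn_integral_cong_AE)
    then have "((\<lambda>x. v x * indicator {a..b} x) has_integral (h b - h a)) UNIV"
      using h_le[of a b] ab by (intro nn_integral_has_integral) (auto simp: v_def)
    moreover have "(\<lambda>x. v x * indicator {a..b} x) = (\<lambda>x. if x \<in> {a..b} then v x else 0)"
      by (auto simp: fun_eq_iff)
    ultimately show ?thesis by (simp only: has_integral_restrict_UNIV)
  qed
  \<comment> \<open>The differentiation theorem used below averages over intervals to the right of a
    point only. The reflected function supplies the left difference quotients.\<close>
  have vint': "((\<lambda>x. v (- x)) has_integral (h (- a) - h (- b))) {a..b}" if ab: "a \<le> b" for a b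
    using has_integral_reflect_real[of v "h (- a) - h (- b)" "- a" "- b"] vint[of "- b" "- a"] ab by simp
  have "v integrable_on cbox a b" "(\<lambda>x. v (- x)) integrable_on cbox a b" for a b :: real
  proof -
    show "v integrable_on cbox a b"
      using vint[of a b] by (cases "a \<le> b") (auto simp: has_integral_integrable)
    show "(\<lambda>x. v (- x)) integrable_on cbox a b"
      using vint'[of a b] by (cases "a \<le> b") (auto simp: has_integral_integrable)
  qed
  note vi = this
  obtain N1 where N1: "negligible N1" "\<And>x e. x \<notin> N1 \<Longrightarrow> 0 < e \<Longrightarrow>
      \<exists>d>0. \<forall>h. 0 < h \<and> h < d \<longrightarrow> norm (integral (cbox x (x + h *\<^sub>R One)) v /\<^sub>R h ^ DIM(real) - v x) < e"
    by (rule integrable_ccontinuous_explicit[OF vi(1)]) blast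
  obtain N2 where N2: "negligible N2" "\<And>x e. x \<notin> N2 \<Longrightarrow> 0 < e \<Longrightarrow>
      \<exists>d>0. \<forall>h. 0 < h \<and> h < d \<longrightarrow> norm (integral (cbox x (x + h *\<^sub>R One)) (\<lambda>x. v (- x)) /\<^sub>R h ^ DIM(real) - v (- x)) < e"
    by (rule integrable_ccontinuous_explicit[OF vi(2)]) blast
  have right: "\<exists>d>0. \<forall>m. 0 < m \<and> m < d \<longrightarrow> \<bar>(h (t + m) - h t) / m - v t\<bar> < e" if t: "t \<notin> N1" "e > 0" for t e
  proof -
    have I: "integral {t..t + m} v = h (t + m) - h t" if "m > 0" for m
      using vint[of t "t + m"] that by (simp add: integral_unique)
    show ?thesis using N1(2)[OF t] by (simp add: I divide_inverse_commute cong: conj_cong imp_cong)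
  qed
  have left: "\<exists>d>0. \<forall>m. 0 < m \<and> m < d \<longrightarrow> \<bar>(h t - h (t - m)) / m - v t\<bar> < e" if t: "- t \<notin> N2" "e > 0" for t e
  proof -
    have I: "integral {- t..m - t} (\<lambda>x. v (- x)) = h t - h (t - m)" if "m > 0" for m
      using vint'[of "- t" "m - t"] that by (simp add: integral_unique)
    show ?thesis using N2(2)[OF t] by (simp add: I divide_inverse_commute cong: conj_cong imp_cong)
  qed
  have der: "(g has_real_derivative (v t - (L + 1))) (at t)" if t: "t \<notin> N1" "- t \<notin> N2" for t
  proof -
    have "(\<lambda>m. (h (t + m) - h t) / m) \<midarrow>0\<rightarrow> v t"
      unfolding LIM_eq
    proof (intro allI impI)
      fix e :: real assume "e > 0"
      obtain d1 where d1: "d1 > 0" "\<And>m. 0 < m \<Longrightarrow> m < d1 \<Longrightarrow> \<bar>(h (t + m) - h t) / m - v t\<bar> < e"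
        using right[OF t(1) \<open>e > 0\<close>] by blast
      obtain d2 where d2: "d2 > 0" "\<And>m. 0 < m \<Longrightarrow> m < d2 \<Longrightarrow> \<bar>(h t - h (t - m)) / m - v t\<bar> < e"
        using left[OF t(2) \<open>e > 0\<close>] by blast
      show "\<exists>s>0. \<forall>m. m \<noteq> 0 \<and> norm (m - 0) < s \<longrightarrow> norm ((h (t + m) - h t) / m - v t) < e"
      proof (intro exI[of _ "min d1 d2"] conjI allI impI)
        fix m :: real assume m: "m \<noteq> 0 \<and> norm (m - 0) < min d1 d2"
        show "norm ((h (t + m) - h t) / m - v t) < e"
        proof (cases "m > 0")
          case True
          then show ?thesis using d1(2)[of m] m by simp
        next
          case False
          then have "\<bar>(h t - h (t - (- m))) / (- m) - v t\<bar> < e" using d2(2)[of "- m"] m by simp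
          also have "(h t - h (t - (- m))) / (- m) = (h (t + m) - h t) / m" by (simp add: field_simps m)
          finally show ?thesis by simp
        qed
      qed (use d1 d2 in simp)
    qed
    then have "(h has_real_derivative v t) (at t)" by (simp add: DERIV_def)
    then have "((\<lambda>x. h x - (L + 1) * x) has_real_derivative (v t - (L + 1) * 1)) (at t)"
      by (rule DERIV_diff[OF _ DERIV_cmult[OF DERIV_ident]])
    then show ?thesis by (simp add: h_def)
  qed
  have "negligible (N1 \<union> uminus ` N2)"
    using N1(1) N2(1) by (intro negligible_Un negligible_differentiable_image_negligible differentiable_on_minus differentiable_on_ident) auto
  then show ?thesis
    unfolding eventually_ae_filter_negligible
  proof (intro exI[of _ "N1 \<union> uminus ` N2"] conjI)
    show "{t. \<not> (\<exists>d. (g has_real_derivative d) (at t))} \<subseteq> N1 \<union> uminus ` N2"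
      using der by (auto simp: image_iff) (metis minus_minus)
  qed
qed

text \<open>Clamping time to {0..T} makes each coordinate globally Lipschitz on the line without
  changing it near interior times. Integer values of T then cover the half-line at the cost of
  countably many null sets.\<close>

lemma lipschitz_halfline_AE_differentiable:
  fixes x :: "real \<Rightarrow> 'a::euclidean_space"
  assumes lip: "\<And>T. T > 0 \<Longrightarrow> \<exists>B. \<forall>t u. 0 \<le> t \<and> t \<le> u \<and> u \<le> T \<longrightarrow> norm (x u - x t) \<le> B * (u - t)"
  shows "AE t in lebesgue. t > 0 \<longrightarrow> (\<exists>d. (x has_vector_derivative d) (at t))"
proof -
  have "AE t in lebesgue. t \<in> {0<..<T} \<longrightarrow> (\<exists>d. ((\<lambda>t. x t \<bullet> i) has_real_derivative d) (at t))"
    if T: "T > 0" and i: "i \<in> Basis" for T i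
  proof -
    obtain B where B: "\<And>t u. 0 \<le> t \<Longrightarrow> t \<le> u \<Longrightarrow> u \<le> T \<Longrightarrow> norm (x u - x t) \<le> B * (u - t)"
      using lip[OF T] by blast
    have "B * T \<ge> 0" using order_trans[OF norm_ge_zero B[of 0 T]] T by simp
    then have B0: "B \<ge> 0" using T by (simp add: zero_le_mult_iff)
    define g where "g t = x (max 0 (min T t)) \<bullet> i" for t
    have "\<bar>g t - g u\<bar> \<le> B * \<bar>t - u\<bar>" for t u
    proof -
      have *: "\<bar>g t - g u\<bar> \<le> B * (t - u)" if "u \<le> t" for t u
      proof -
        have "\<bar>g t - g u\<bar> \<le> norm (x (max 0 (min T t)) - x (max 0 (min T u)))"
          unfolding g_def inner_diff_left[symmetric] using Basis_le_norm[OF i] by auto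
        also have "\<dots> \<le> B * (max 0 (min T t) - max 0 (min T u))"
          by (rule B) (use that T in auto)
        also have "\<dots> \<le> B * (t - u)" using that T B0 by (intro mult_left_mono) auto
        finally show ?thesis .
      qed
      show ?thesis using *[of t u] *[of u t] by (cases "u \<le> t") (auto simp: abs_minus_commute)
    qed
    from lipschitz_AE_differentiable[OF this] show ?thesis
    proof eventually_elim
      case (elim t)
      show ?case
      proof
        assume t: "t \<in> {0<..<T}"
        obtain d where "(g has_real_derivative d) (at t)" using elim by blast
        moreover have "\<forall>\<^sub>F s in nhds t. g s = x s \<bullet> i"
          using eventually_nhds_in_open[OF open_greaterThanLessThan t]
          by eventually_elim (auto simp: g_def)
        then have "(g has_real_derivative d) (at t) = ((\<lambda>s. x s \<bullet> i) has_real_derivative d) (at t)"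
          by (rule DERIV_cong_ev[OF refl _ refl])
        ultimately show "\<exists>d. ((\<lambda>t. x t \<bullet> i) has_real_derivative d) (at t)" by blast
      qed
    qed
  qed
  then have "AE t in lebesgue. \<forall>i\<in>Basis. t \<in> {0<..<real (Suc n)} \<longrightarrow> (\<exists>d. ((\<lambda>t. x t \<bullet> i) has_real_derivative d) (at t))" for n
    by (intro AE_finite_allI finite_Basis) simp
  then have "AE t in lebesgue. \<forall>n. \<forall>i\<in>Basis. t \<in> {0<..<real (Suc n)} \<longrightarrow> (\<exists>d. ((\<lambda>t. x t \<bullet> i) has_real_derivative d) (at t))"
    by (simp only: AE_all_countable) blast
  then show ?thesis
  proof eventually_elim
    case (elim t)
    show ?case
    proof
      assume "t > 0"
      moreover obtain n where "t < real n" using reals_Archimedean2 by blast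
      ultimately have "t \<in> {0<..<real (Suc n)}" by simp
      then obtain D where D: "\<And>i. i \<in> Basis \<Longrightarrow> ((\<lambda>t. x t \<bullet> i) has_real_derivative (D i)) (at t)"
        using elim by metis
      have "(x has_vector_derivative (\<Sum>i\<in>Basis. D i *\<^sub>R i)) (at t)"
        unfolding has_vector_derivative_def
        by (subst has_derivative_componentwise_within)
           (use D in \<open>auto simp: has_field_derivative_def mult.commute[of _ "D _"] inner_sum_left_Basis\<close>)
      then show "\<exists>d. (x has_vector_derivative d) (at t)" by blast
    qed
  qed
qed

text \<open>Explicit Euler iterates converge although f is discontinuous: passing to half the step size adds
  to the squared distance at most a constant times the squared step size in each step, because
  dissipativity of f removes the first-order term.\<close>
theorem dissipative_filippov_solution_exists:
  fixes f :: "'a::euclidean_space \<Rightarrow> 'a"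
  assumes diss: "\<And>x y. (x - y) \<bullet> (f x - f y) \<le> 0"
    and growth: "\<And>x. norm (f x) \<le> K * (1 + norm x)"
    and reg: "\<And>x \<delta> S. \<delta> > 0 \<Longrightarrow> S \<in> null_sets lebesgue \<Longrightarrow> f x \<in> closure (convex hull (f ` (ball x \<delta> - S)))"
  shows "\<exists>x. filippov_solution f x0 x"
proof -
  have K: "K \<ge> 0" using order_trans[OF norm_ge_zero growth[of 0]] by simp
  \<comment> \<open>Halving makes each grid contain the previous one, so iterates can be compared at
    common times.\<close>
  define h where "h n = (1 / 2 :: real) ^ n" for n
  have h: "h n > 0" "h n = 2 * h (Suc n)" for n by (auto simp: h_def)
  define Y where "Y n k = ((\<lambda>x. x + h n *\<^sub>R f x) ^^ k) x0" for n k
  have Y0: "Y n 0 = x0" and YS: "Y n (Suc k) = Y n k + h n *\<^sub>R f (Y n k)" for n k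
    by (simp_all add: Y_def)
  \<comment> \<open>Bounds f along all iterates up to time T, whatever the step size; the
    exponential comes from the discrete Gronwall estimate \<open>Ybound\<close>. The summand 1 makes
    \<open>B T\<close> positive, since it is divided by later.\<close>
  define B where "B T = K * ((1 + norm x0) * exp (K * T)) + 1" for T
  have B0: "B T > 0" for T using K by (simp add: B_def add_nonneg_pos)
  have Ybound: "1 + norm (Y n k) \<le> (1 + norm x0) * exp (K * (real k * h n))" for n k
  proof (induction k)
    case (Suc k)
    have "1 + norm (Y n (Suc k)) \<le> 1 + norm (Y n k) + h n * norm (f (Y n k))"
      unfolding YS using norm_triangle_ineq[of "Y n k" "h n *\<^sub>R f (Y n k)"] h(1)[of n] by simp
    also have "\<dots> \<le> 1 + norm (Y n k) + h n * (K * (1 + norm (Y n k)))"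
      using growth[of "Y n k"] h(1)[of n] by (intro add_left_mono mult_left_mono) auto
    also have "\<dots> = (1 + norm (Y n k)) * (1 + K * h n)" by (simp add: algebra_simps)
    also have "\<dots> \<le> (1 + norm x0) * exp (K * (real k * h n)) * exp (K * h n)"
      using Suc K h(1)[of n] exp_ge_add_one_self[of "K * h n"] by (intro mult_mono) auto
    also have "\<dots> = (1 + norm x0) * exp (K * (real (Suc k) * h n))"
      by (simp add: algebra_simps exp_add)
    finally show ?case .
  qed (simp add: Y0)
  have fB: "norm (f (Y n k)) \<le> B T" if "real k * h n \<le> T" for n k T
  proof -
    have "norm (f (Y n k)) \<le> K * ((1 + norm x0) * exp (K * (real k * h n)))"
      using growth[of "Y n k"] mult_left_mono[OF Ybound K] by (meson order_trans)
    also have "\<dots> \<le> K * ((1 + norm x0) * exp (K * T))"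
      using K that by (intro mult_left_mono) (auto intro: mult_left_mono)
    finally show ?thesis by (simp add: B_def)
  qed
  have Ylip: "norm (Y n (j + m) - Y n j) \<le> B T * (h n * real m)" if "real (j + m) * h n \<le> T" for n j m T
    using that
  proof (induction m)
    case (Suc m)
    have le: "real (j + m) * h n \<le> T"
      by (rule order_trans[OF _ Suc.prems]) (use h(1)[of n] in \<open>auto intro!: mult_right_mono\<close>)
    have "norm (Y n (j + Suc m) - Y n j) \<le> norm (Y n (j + m) - Y n j) + h n * norm (f (Y n (j + m)))"
      using norm_triangle_ineq[of "Y n (j + m) - Y n j" "h n *\<^sub>R f (Y n (j + m))"] h(1)[of n] by (simp add: YS algebra_simps)
    also have "\<dots> \<le> B T * (h n * real m) + h n * B T"
      using Suc.IH[OF le] fB[OF le] h(1)[of n] by (intro add_mono mult_left_mono) auto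
    finally show ?case by (simp add: algebra_simps)
  qed simp
  \<comment> \<open>The constant is 20 = 4 + 16: in each coarse step, with k the fine step size, 4
    \<open>k\<^sup>2 * (B T)\<^sup>2\<close> comes from \<open>DQ\<close> and 16
    \<open>k\<^sup>2 * (B T)\<^sup>2\<close> from the squared increment.\<close>
  have refine: "(norm (Y n j - Y (Suc n) (2 * j)))\<^sup>2 \<le> 20 * (h (Suc n))\<^sup>2 * (B T)\<^sup>2 * real j"
    if "real j * h n \<le> T" for n j T
    using that
  proof (induction j)
    case (Suc j)
    define k where "k = h (Suc n)"
    have k: "k > 0" "h n = 2 * k" using h(1)[of "Suc n"] h(2)[of n] by (simp_all add: k_def)
    define a where "a = Y n j"
    define b where "b = Y (Suc n) (2 * j)"
    define b' where "b' = Y (Suc n) (Suc (2 * j))"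
    have b': "b' = b + k *\<^sub>R f b" by (simp add: b'_def b_def YS k_def)
    define P where "P = f a - f b"
    define Q where "Q = f a - f b'"
    have le: "real j * h n \<le> T" using Suc.prems h(1)[of n] by (simp add: algebra_simps)
    have bnd: "norm (f a) \<le> B T" "norm (f b) \<le> B T" "norm (f b') \<le> B T"
      unfolding a_def b_def b'_def
      by (rule fB; use Suc.prems k in \<open>simp add: algebra_simps k_def[symmetric]\<close>)+
    have Pn: "norm P \<le> 2 * B T" and Qn: "norm Q \<le> 2 * B T"
      unfolding P_def Q_def using bnd norm_triangle_ineq4[of "f a" "f b"] norm_triangle_ineq4[of "f a" "f b'"] by linarith+
    \<comment> \<open>Dissipativity controls Q against a - b', not a - b. The two differ by one fine
      step, and this mismatch is of first order in k.\<close>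
    have DQ: "(a - b) \<bullet> Q \<le> 2 * k * (B T)\<^sup>2"
    proof -
      have "(a - b) \<bullet> Q = (a - b') \<bullet> Q + (k *\<^sub>R f b) \<bullet> Q" by (simp add: b' inner_diff_left inner_add_left)
      also have "(a - b') \<bullet> Q \<le> 0" unfolding Q_def by (rule diss)
      also have "(k *\<^sub>R f b) \<bullet> Q \<le> norm (k *\<^sub>R f b) * norm Q" by (rule norm_cauchy_schwarz)
      also have "\<dots> \<le> (k * B T) * (2 * B T)"
        using bnd Qn k B0[of T] by (intro mult_mono) auto
      finally show ?thesis by (simp add: power2_eq_square algebra_simps)
    qed
    \<comment> \<open>One coarse step is read as two half steps with the same value f a, to be
      compared with f b and f b' in turn.\<close>
    have eq: "Y n (Suc j) - Y (Suc n) (2 * Suc j) = (a - b) + k *\<^sub>R (P + Q)"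
      using b' by (simp add: YS a_def[symmetric] b_def[symmetric] b'_def[symmetric] k P_def Q_def algebra_simps flip: k_def)
        (simp add: b_def b'_def YS k_def algebra_simps scaleR_2[symmetric])
    have "(norm (Y n (Suc j) - Y (Suc n) (2 * Suc j)))\<^sup>2
        = (norm (a - b))\<^sup>2 + 2 * k * ((a - b) \<bullet> P) + 2 * k * ((a - b) \<bullet> Q) + k\<^sup>2 * (norm (P + Q))\<^sup>2"
      unfolding eq power2_norm_eq_inner
      by (simp add: inner_add_left inner_add_right inner_commute power2_eq_square algebra_simps)
    also have "\<dots> \<le> 20 * k\<^sup>2 * (B T)\<^sup>2 * real j + 0 + 2 * k * (2 * k * (B T)\<^sup>2) + k\<^sup>2 * (4 * B T)\<^sup>2"
    proof (intro add_mono)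
      show "(norm (a - b))\<^sup>2 \<le> 20 * k\<^sup>2 * (B T)\<^sup>2 * real j" using Suc.IH[OF le] by (simp add: a_def b_def k_def)
      show "2 * k * ((a - b) \<bullet> P) \<le> 0" using diss[of a b] k by (simp add: P_def mult_nonneg_nonpos)
      show "2 * k * ((a - b) \<bullet> Q) \<le> 2 * k * (2 * k * (B T)\<^sup>2)" using DQ k by (intro mult_left_mono) auto
      have "norm (P + Q) \<le> 4 * B T" using norm_triangle_ineq[of P Q] Pn Qn by linarith
      then show "k\<^sup>2 * (norm (P + Q))\<^sup>2 \<le> k\<^sup>2 * (4 * B T)\<^sup>2" by (intro mult_left_mono power_mono) auto
    qed
    also have "\<dots> = 20 * k\<^sup>2 * (B T)\<^sup>2 * real (Suc j)" by (simp add: power2_eq_square algebra_simps)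
    finally show ?case by (simp add: k_def)
  qed (simp add: Y0)
  \<comment> \<open>The number of steps completed by time t; \<open>y n\<close> is the piecewise
    constant interpolation.\<close>
  define N where "N n t = nat \<lfloor>t / h n\<rfloor>" for n t
  define y where "y n t = Y n (N n t)" for n t
  have N: "real (N n t) * h n \<le> t" "t < real (N n t) * h n + h n" if "t \<ge> 0" for n t
  proof -
    have "real (N n t) = of_int \<lfloor>t / h n\<rfloor>" using that h(1)[of n] by (simp add: N_def)
    moreover have "of_int \<lfloor>t / h n\<rfloor> * h n \<le> t"
      using h(1)[of n] by (simp flip: pos_le_divide_eq)
    moreover have "t < (of_int \<lfloor>t / h n\<rfloor> + 1) * h n"
      using h(1)[of n] floor_correct[of "t / h n"] by (simp flip: pos_divide_less_eq)
    ultimately show "real (N n t) * h n \<le> t" "t < real (N n t) * h n + h n"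
      by (simp_all add: distrib_right)
  qed
  have N_mono: "N n t \<le> N n u" if "t \<le> u" for n t u
    unfolding N_def using that h(1)[of n] by (intro nat_mono floor_mono divide_right_mono) auto
  have N_Suc: "N (Suc n) t = 2 * N n t \<or> N (Suc n) t = 2 * N n t + 1" if "t \<ge> 0" for n t
  proof -
    have "real (2 * N n t) * h (Suc n) < (real (N (Suc n) t) + 1) * h (Suc n)"
         "real (N (Suc n) t) * h (Suc n) < (real (2 * N n t) + 2) * h (Suc n)"
      using N[OF that, of n] N[OF that, of "Suc n"] h(2)[of n] by (auto simp: algebra_simps)
    then have "real (2 * N n t) < real (N (Suc n) t) + 1" "real (N (Suc n) t) < real (2 * N n t) + 2"
      using h(1)[of "Suc n"] by (auto simp: mult_less_cancel_right)
    then show ?thesis by linarith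
  qed
  \<comment> \<open>About T / h n steps, each adding order \<open>(h n)\<^sup>2\<close> to the
    squared gap, leave a gap of order sqrt (h n). This is geometric in n and therefore summable. The
    fine grid may be one step ahead, which costs at most \<open>B T * h n\<close>.\<close>
  have y_step: "norm (y (Suc n) t - y n t) \<le> (sqrt (20 * T) + 1) * B T * sqrt (1 / 2) ^ n"
    if t: "0 \<le> t" "t \<le> T" for n t T
  proof -
    define r where "r = sqrt (1 / 2)"
    have r: "0 \<le> r" "r \<le> 1" "r ^ n \<ge> 0" and hr: "h n = r ^ n * r ^ n" for n
      by (auto simp: r_def h_def power_mult_distrib[symmetric])
    have Nt: "real (N n t) * h n \<le> T" using N(1)[of t n] t by simp
    have "(norm (Y n (N n t) - Y (Suc n) (2 * N n t)))\<^sup>2 \<le> 20 * (h (Suc n))\<^sup>2 * (B T)\<^sup>2 * real (N n t)"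
      by (rule refine[OF Nt])
    also have "\<dots> = (real (N n t) * h n) * (5 * h n * (B T)\<^sup>2)"
      by (simp add: h(2)[of n] power2_eq_square)
    also have "\<dots> \<le> T * (20 * h n * (B T)\<^sup>2)"
      using Nt t h(1)[of n] by (intro mult_mono) auto
    also have "\<dots> = (sqrt (20 * T) * B T * r ^ n)\<^sup>2"
      using t by (simp add: hr power_mult_distrib power2_eq_square)
    finally have 1: "norm (Y n (N n t) - Y (Suc n) (2 * N n t)) \<le> sqrt (20 * T) * B T * r ^ n"
      by (rule power2_le_imp_le) (use r B0[of T] t in auto)
    have 2: "norm (y (Suc n) t - Y (Suc n) (2 * N n t)) \<le> B T * r ^ n"
    proof -
      obtain m where m: "N (Suc n) t = 2 * N n t + m" "m \<le> 1" using N_Suc[OF t(1), of n] by force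
      have "norm (y (Suc n) t - Y (Suc n) (2 * N n t)) \<le> B T * (h (Suc n) * real m)"
        unfolding y_def m(1) by (rule Ylip) (use N(1)[of t "Suc n"] m t in auto)
      also have "\<dots> \<le> B T * (h n * 1)"
        using h(1)[of "Suc n"] m(2) B0[of T] unfolding h(2)[of n] by (intro mult_left_mono mult_mono) auto
      also have "\<dots> \<le> B T * (r ^ n * 1)"
        unfolding hr using r B0[of T] by (intro mult_left_mono) (auto simp: power_le_one mult_left_le)
      finally show ?thesis by simp
    qed
    have "norm (y (Suc n) t - y n t) \<le> norm (y (Suc n) t - Y (Suc n) (2 * N n t)) + norm (Y n (N n t) - Y (Suc n) (2 * N n t))"
      unfolding y_def by (metis norm_triangle_sub norm_minus_commute norm_triangle_le diff_add_cancel dist_norm dist_triangle2)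
    then show ?thesis using 1 2 by (simp add: r_def algebra_simps)
  qed
  define x where "x t = lim (\<lambda>n. y n t)" for t
  have lim: "(\<lambda>n. y n t) \<longlonglongrightarrow> x t" if "t \<ge> 0" for t
  proof -
    have "summable (\<lambda>n. y (Suc n) t - y n t)"
    proof (rule summable_comparison_test)
      show "\<exists>N. \<forall>n\<ge>N. norm (y (Suc n) t - y n t) \<le> (sqrt (20 * t) + 1) * B t * sqrt (1 / 2) ^ n"
        using y_step[of t t] that by blast
      have "norm (sqrt (1 / 2) :: real) < 1" by (simp add: real_sqrt_lt_1_iff)
      then show "summable (\<lambda>n. (sqrt (20 * t) + 1) * B t * sqrt (1 / 2) ^ n)"
        by (intro summable_mult summable_geometric)
    qed
    then have "convergent (\<lambda>n. \<Sum>k<n. y (Suc k) t - y k t)"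
      by (simp add: summable_iff_convergent)
    then have "convergent (\<lambda>n. y n t - y 0 t)" by (simp only: sum_lessThan_telescope[of "\<lambda>n. y n t"])
    then obtain l where "(\<lambda>n. y n t - y 0 t) \<longlonglongrightarrow> l" by (auto simp: convergent_def)
    then have "(\<lambda>n. (y n t - y 0 t) + y 0 t) \<longlonglongrightarrow> l + y 0 t" by (intro tendsto_intros)
    then show ?thesis unfolding x_def by (simp add: convergent_def convergent_LIMSEQ_iff[symmetric] limI)
  qed
  have h_lim: "h \<longlonglongrightarrow> 0" unfolding h_def by (intro LIMSEQ_power_zero) simp
  have Nh_lim: "(\<lambda>n. h n * real (N n t)) \<longlonglongrightarrow> t" if "t \<ge> 0" for t
  proof (rule tendsto_sandwich[of "\<lambda>n. t - h n" _ _ "\<lambda>n. t"])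
    show "\<forall>\<^sub>F n in sequentially. t - h n \<le> h n * real (N n t)"
      using N(2)[OF that] by (intro always_eventually allI) (simp add: algebra_simps less_imp_le)
    show "\<forall>\<^sub>F n in sequentially. h n * real (N n t) \<le> t"
      using N(1)[OF that] by (intro always_eventually allI) (simp add: mult.commute)
    show "(\<lambda>n. t - h n) \<longlonglongrightarrow> t" using tendsto_diff[OF tendsto_const h_lim, of t] by simp
  qed simp
  \<comment> \<open>The interpolations jump and are not Lipschitz in t. The bound is stated in grid
    times, which converge to the true times, so the limit is Lipschitz.\<close>
  have y_lip: "norm (y n u - y n t) \<le> B T * (h n * real (N n u) - h n * real (N n t))"
    if "0 \<le> t" "t \<le> u" "u \<le> T" for n t u T
  proof -
    define m where "m = N n u - N n t"
    have m: "N n u = N n t + m" using N_mono[OF that(2), of n] by (simp add: m_def)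
    have "norm (y n u - y n t) \<le> B T * (h n * real m)"
      unfolding y_def m by (rule Ylip) (use N(1)[of u n] that m in auto)
    then show ?thesis by (simp add: m algebra_simps)
  qed
  have x_lip: "norm (x u - x t) \<le> B T * (u - t)" if tu: "0 \<le> t" "t \<le> u" "u \<le> T" for t u T
  proof (rule LIMSEQ_le)
    show "(\<lambda>n. norm (y n u - y n t)) \<longlonglongrightarrow> norm (x u - x t)"
      using tu by (intro tendsto_intros lim) auto
    show "(\<lambda>n. B T * (h n * real (N n u) - h n * real (N n t))) \<longlonglongrightarrow> B T * (u - t)"
      using tu by (intro tendsto_intros Nh_lim) auto
    show "\<exists>M. \<forall>n\<ge>M. norm (y n u - y n t) \<le> B T * (h n * real (N n u) - h n * real (N n t))"
      using y_lip[OF tu] by blast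
  qed
  have x0: "x 0 = x0"
  proof -
    have "y n 0 = x0" for n by (simp add: y_def N_def Y0)
    then show ?thesis using LIMSEQ_unique[OF lim[of 0]] by simp
  qed
  \<comment> \<open>A difference quotient of \<open>x\<close> is a limit of quotients of
    \<open>y n\<close> over grid times, and each of those is an average of values of f at iterates
    near x t. Convexity and closedness of \<open>C\<close> carry this to the derivative.\<close>
  have incl: "d \<in> filippov_set f (x t)" if d: "(x has_vector_derivative d) (at t)" and t: "t \<ge> 0" for t d
    unfolding filippov_set_def
  proof (intro INT_I)
    fix \<delta> :: real and S :: "'a set" assume "\<delta> \<in> {0<..}" and S: "S \<in> null_sets lebesgue"
    then have \<delta>: "\<delta> > 0" by simp
    define C where "C = closure (convex hull (f ` (ball (x t) \<delta> - S)))"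
    have C: "closed C" "convex C" by (simp_all add: C_def convex_closure convex_convex_hull)
    \<comment> \<open>The iterates are specific points and may well lie in S. Applying
      \<open>reg\<close> in a smaller ball around such a point still places the value of f in
      \<open>C\<close>.\<close>
    have fC: "f z \<in> C" if z: "dist (x t) z < \<delta> / 2" for z
    proof -
      have "ball z (\<delta> / 2) \<subseteq> ball (x t) \<delta>"
      proof
        fix w assume "w \<in> ball z (\<delta> / 2)"
        then show "w \<in> ball (x t) \<delta>" using dist_triangle_half_r[of z "x t" \<delta> w] z by (simp add: dist_commute)
      qed
      then have "closure (convex hull (f ` (ball z (\<delta> / 2) - S))) \<subseteq> C"
        unfolding C_def by (intro closure_mono hull_mono image_mono) auto
      then show ?thesis using reg[of "\<delta> / 2" S z] \<delta> S by auto
    qed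
    define T where "T = t + 1"
    \<comment> \<open>The distance budget \<delta> / 2 is met by \<delta> / 8 for y n t against x t,
      and by twice \<delta> / 8 for the motion during \<tau> and at most one further step. The bound
      1 keeps all times below T.\<close>
    define \<tau>0 where "\<tau>0 = min 1 (\<delta> / (8 * B T))"
    have \<tau>0: "\<tau>0 > 0" using \<delta> B0[of T] by (simp add: \<tau>0_def)
    have quot: "(x (t + \<tau>) - x t) /\<^sub>R \<tau> \<in> C" if \<tau>: "0 < \<tau>" "\<tau> < \<tau>0" for \<tau>
    proof -
      define q where "q n = h n * real (N n (t + \<tau>)) - h n * real (N n t)" for n
      have q_lim: "q \<longlonglongrightarrow> \<tau>"
        using tendsto_diff[OF Nh_lim[of "t + \<tau>"] Nh_lim[of t]] t \<tau> unfolding q_def by simp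
      have "\<forall>\<^sub>F n in sequentially. (y n (t + \<tau>) - y n t) /\<^sub>R q n \<in> C"
      proof -
        have "\<forall>\<^sub>F n in sequentially. dist (y n t) (x t) < \<delta> / 8" using lim[OF t] \<delta> by (intro tendstoD) auto
        moreover have "\<forall>\<^sub>F n in sequentially. h n < \<delta> / (8 * B T)"
          using order_tendstoD(2)[OF h_lim] \<delta> B0[of T] by simp
        moreover have "\<forall>\<^sub>F n in sequentially. q n > 0" using order_tendstoD(1)[OF q_lim] \<tau> by simp
        ultimately show ?thesis
        proof eventually_elim
          case (elim n)
          define a where "a = N n t"
          define m where "m = N n (t + \<tau>) - a"
          have m: "N n (t + \<tau>) = a + m" using N_mono[of t "t + \<tau>" n] \<tau> by (simp add: m_def a_def)
          have q: "q n = h n * real m" unfolding q_def m a_def[symmetric] by (simp add: algebra_simps)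
          have m0: "m > 0" using elim(3) q h(1)[of n] by (simp add: zero_less_mult_iff)
          have "Y n (a + i) - Y n a = h n *\<^sub>R (\<Sum>j<i. f (Y n (a + j)))" for i
            by (induction i) (simp_all add: YS algebra_simps)
          then have "y n (t + \<tau>) - y n t = h n *\<^sub>R (\<Sum>j<m. f (Y n (a + j)))" by (simp add: y_def m a_def)
          then have avg: "(y n (t + \<tau>) - y n t) /\<^sub>R q n = (\<Sum>j<m. (1 / real m) *\<^sub>R f (Y n (a + j)))"
            using q h(1)[of n] by (simp add: scaleR_sum_right[symmetric] field_simps)
          have "f (Y n (a + j)) \<in> C" if j: "j < m" for j
          proof (rule fC)
            have "real (a + j) * h n \<le> real (a + m) * h n" using j h(1)[of n] by simp
            also have "\<dots> \<le> t + \<tau>" using N(1)[of "t + \<tau>" n] m t \<tau> by simp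
            finally have jt: "real (a + j) * h n \<le> t + \<tau>" .
            also have "t + \<tau> \<le> T" using \<tau> by (simp add: T_def \<tau>0_def)
            finally have "norm (Y n (a + j) - Y n a) \<le> B T * (h n * real j)" by (rule Ylip)
            also have "h n * real j \<le> \<tau> + h n"
              using jt N(2)[of t n] t by (simp add: a_def algebra_simps)
            also have "\<tau> + h n \<le> \<delta> / (8 * B T) + \<delta> / (8 * B T)" using \<tau> elim(2) by (simp add: \<tau>0_def)
            also have "B T * (\<delta> / (8 * B T) + \<delta> / (8 * B T)) = \<delta> / 4" using B0[of T] by (simp add: field_simps)
            finally have "norm (Y n (a + j) - Y n a) \<le> \<delta> / 4" using B0[of T] by simp
            then have "dist (Y n (a + j)) (y n t) \<le> \<delta> / 4" by (simp add: dist_norm y_def a_def)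
            then show "dist (x t) (Y n (a + j)) < \<delta> / 2"
              using elim(1) dist_triangle[of "x t" "Y n (a + j)" "y n t"] \<delta> by (simp add: dist_commute)
          qed
          then show ?case unfolding avg using m0 by (intro convex_sum C) auto
        qed
      qed
      moreover have "(\<lambda>n. (y n (t + \<tau>) - y n t) /\<^sub>R q n) \<longlonglongrightarrow> (x (t + \<tau>) - x t) /\<^sub>R \<tau>"
        using t \<tau> by (intro tendsto_intros lim q_lim) auto
      ultimately show ?thesis by (intro Lim_in_closed_set[OF C(1)]) auto
    qed
    have "((\<lambda>\<tau>. (x (t + \<tau>) - x t) /\<^sub>R \<tau>) \<longlongrightarrow> d) (at_right 0)"
    proof -
      have "((\<lambda>\<tau>. (x (t + \<tau>) - x t) /\<^sub>R \<tau>) \<longlongrightarrow> d) (at 0)"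
      proof -
        have A: "(\<lambda>\<tau>. norm (x (t + \<tau>) - x t - \<tau> *\<^sub>R d) / norm \<tau>) \<midarrow>0\<rightarrow> 0"
          using d unfolding has_vector_derivative_def has_derivative_at by blast
        have eq: "norm (x (t + \<tau>) - x t - \<tau> *\<^sub>R d) / norm \<tau> = norm ((x (t + \<tau>) - x t) /\<^sub>R \<tau> - d)"
          if "\<tau> \<noteq> 0" for \<tau>
        proof -
          have "(x (t + \<tau>) - x t) /\<^sub>R \<tau> - d = (x (t + \<tau>) - x t - \<tau> *\<^sub>R d) /\<^sub>R \<tau>"
            using that by (simp add: scaleR_diff_right)
          then show ?thesis by (simp add: divide_inverse_commute)
        qed
        have "(\<lambda>\<tau>. norm ((x (t + \<tau>) - x t) /\<^sub>R \<tau> - d)) \<midarrow>0\<rightarrow> 0"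
          by (rule iffD1[OF LIM_equal A]) (use eq in blast)
        then show ?thesis by (rule LIM_zero_cancel[OF tendsto_norm_zero_cancel])
      qed
      then show ?thesis by (rule tendsto_mono[rotated]) (simp add: at_le)
    qed
    moreover have "\<forall>\<^sub>F \<tau> in at_right 0. (x (t + \<tau>) - x t) /\<^sub>R \<tau> \<in> C"
      using \<tau>0 quot by (auto simp: eventually_at_right)
    ultimately show "d \<in> closure (convex hull (f ` (ball (x t) \<delta> - S)))"
      unfolding C_def[symmetric] by (intro Lim_in_closed_set[OF C(1)]) auto
  qed
  have "filippov_solution f x0 x"
    unfolding filippov_solution_def
  proof (intro conjI allI impI x0)
    show "abs_cont_on {0..T} x" if "T \<ge> 0" for T
      by (rule abs_cont_on_lipschitz[of _ _ "B T"]) (use x_lip[of _ _ T] B0 in auto)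
    have "AE t in lebesgue. t > 0 \<longrightarrow> (\<exists>d. (x has_vector_derivative d) (at t))"
      by (rule lipschitz_halfline_AE_differentiable) (use x_lip in blast)
    \<comment> \<open>The derivative \<open>at t\<close> is two-sided, but \<open>x\<close> is
      controlled only for nonnegative times, so time 0 is discarded as a null set.\<close>
    moreover have "AE t in lebesgue. t \<noteq> (0::real)"
      unfolding eventually_ae_filter_negligible by (rule exI[of _ "{0}"]) auto
    ultimately show "AE t in lebesgue. 0 \<le> t \<longrightarrow> (\<exists>d. (x has_vector_derivative d) (at t) \<and> d \<in> filippov_set f (x t))"
      by eventually_elim (use incl in force)
  qed
  then show ?thesis by blast
qed

section \<open>Median consensus\<close>

locale median_consensus =
  fixes \<alpha> :: "'n::finite \<Rightarrow> 'n \<Rightarrow> real" and z s :: "'n \<Rightarrow> real" and \<gamma> :: real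
  assumes N2: "CARD('n) \<ge> 2"
    and adj01: "\<And>i j. \<alpha> i j \<in> {0, 1}"
    and adj_sym: "\<And>i j. \<alpha> i j = \<alpha> j i"
    and conn: "graph_connected \<alpha>"
    and s01: "\<And>i. s i \<in> {0, 1}"
    and s_some: "\<exists>i. s i = 1"
    and \<gamma>_pos: "\<gamma> > 0"
begin

section \<open>Mean and disagreement components\<close>

abbreviation "L \<equiv> laplacian \<alpha>"
abbreviation "F \<equiv> median_field \<alpha> z s \<gamma>"

definition mean :: "real^'n \<Rightarrow> real" where "mean v = (\<Sum>i\<in>UNIV. v $ i) / real CARD('n)"
definition disagreement :: "real^'n \<Rightarrow> real^'n" where "disagreement v = (\<chi> i. v $ i - mean v)"
text \<open>The size of the disagreement at which the bound in \<open>disagreement_decay\<close>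
  changes sign.\<close>

definition radius :: real where "radius = sqrt (real CARD('n)) / (\<gamma> * lambda2 L)"

lemma lambda2_pos: "lambda2 L > 0"
  by (rule lambda2_laplacian[OF N2 adj01 adj_sym conn])

lemma coupling_eq: "(\<Sum>j\<in>{j. \<alpha> i j = 1}. x $ j - x $ i) = - (L *v x) $ i"
proof -
  have "(L *v x) $ i = (\<Sum>j\<in>UNIV. if \<alpha> i j = 1 then x $ i - x $ j else 0)"
    unfolding laplacian_mult using adj01[of i] by (intro sum.cong) force+
  also have "\<dots> = (\<Sum>j\<in>{j. \<alpha> i j = 1}. x $ i - x $ j)" by (simp add: sum.If_cases)
  finally show ?thesis by (simp add: sum_negf[symmetric])
qed

lemma field_eq: "F x = (\<chi> i. s i * sgn (z i - x $ i)) - \<gamma> *\<^sub>R (L *v x)"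
  by (simp add: vec_eq_iff median_field_def coupling_eq)

lemma sum_laplacian: "(\<Sum>i\<in>UNIV. (L *v x) $ i) = 0"
proof -
  have "(\<chi> i. 1) \<bullet> (L *v x) = 0" by (simp add: laplacian_self_adjoint[OF adj_sym] laplacian_const)
  then show ?thesis by (simp add: inner_vec_def)
qed

lemma sum_disagreement: "(\<Sum>i\<in>UNIV. disagreement v $ i) = 0"
  by (simp add: disagreement_def mean_def sum_subtractf)

lemma linear_mean: "linear mean"
  by (rule linearI) (simp_all add: mean_def sum.distrib add_divide_distrib sum_distrib_left[symmetric])

lemma linear_disagreement: "linear disagreement"
  by (rule linearI)
     (simp_all add: disagreement_def vec_eq_iff linear_add[OF linear_mean] linear_scale[OF linear_mean] algebra_simps)

lemma laplacian_disagreement: "L *v disagreement v = L *v v"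
proof -
  have "disagreement v = v - (\<chi> i. mean v)" by (simp add: disagreement_def vec_eq_iff)
  then show ?thesis by (simp add: matrix_vector_mult_diff_distrib laplacian_const)
qed

text \<open>\<open>disagreement\<close> is the orthogonal projection onto the complement of the
  constants, so projecting the second factor changes nothing. The decay estimate can thus be made
  with the full velocity d.\<close>

lemma inner_disagreement: "disagreement v \<bullet> disagreement d = disagreement v \<bullet> d"
proof -
  have "disagreement d = d - mean d *\<^sub>R (\<chi> i. 1)" by (simp add: disagreement_def vec_eq_iff)
  moreover have "disagreement v \<bullet> (\<chi> i. 1) = 0" using sum_disagreement[of v] by (simp add: inner_vec_def)
  ultimately show ?thesis by (simp add: inner_diff_right)
qed

lemma abs_cont_on_linear_compose:
  fixes g :: "real^'n \<Rightarrow> 'b::euclidean_space"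
  assumes "abs_cont_on I x" "linear g"
  shows "abs_cont_on I (\<lambda>t. g (x t))"
proof -
  obtain C where "\<And>v. norm (g v) \<le> C * norm v" using linear_bounded[OF assms(2)] by blast
  then show ?thesis
    by (intro abs_cont_on_lipschitz_compose[OF assms(1), of g C]) (simp add: linear_diff[OF assms(2), symmetric])
qed

text \<open>Rewrites the inclusion as a selection \<open>w\<close> of the set-valued sign term plus
  linear coupling. The estimates below draw on the Filippov set only through this form.\<close>

lemma velocity:
  assumes "d \<in> filippov_set F x"
  obtains w where "d = w - \<gamma> *\<^sub>R (L *v x)" "\<And>i. \<bar>w $ i\<bar> \<le> s i"
    "\<And>i. z i < x $ i \<Longrightarrow> w $ i = - s i" "\<And>i. x $ i < z i \<Longrightarrow> w $ i = s i"
proof (rule that)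
  define w where "w = (\<chi> i. d $ i - \<gamma> * (\<Sum>j\<in>{j. \<alpha> i j = 1}. x $ j - x $ i))"
  show "d = w - \<gamma> *\<^sub>R (L *v x)" by (simp add: w_def vec_eq_iff coupling_eq)
  show "\<bar>w $ i\<bar> \<le> s i" "z i < x $ i \<Longrightarrow> w $ i = - s i" "x $ i < z i \<Longrightarrow> w $ i = s i" for i
    using filippov_set_median_field[OF assms s01, of i] by (simp_all add: w_def)
qed

text \<open>Cauchy--Schwarz bounds the sign part by sqrt N times the norm of the disagreement. The
  coupling sees only the disagreement, whose entries sum to zero, so the spectral gap
  applies.\<close>

lemma disagreement_decay:
  assumes d: "d \<in> filippov_set F x"
  shows "disagreement x \<bullet> d \<le> norm (disagreement x) * (sqrt (real CARD('n)) - \<gamma> * lambda2 L * norm (disagreement x))"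
proof -
  let ?e = "disagreement x"
  obtain w where w: "d = w - \<gamma> *\<^sub>R (L *v x)" "\<And>i. \<bar>w $ i\<bar> \<le> s i"
    by (rule velocity[OF d]) blast
  have "(norm w)\<^sup>2 \<le> real CARD('n)"
  proof -
    have "(norm w)\<^sup>2 = (\<Sum>i\<in>UNIV. (w $ i)\<^sup>2)"
      unfolding power2_norm_eq_inner inner_vec_def by (simp add: power2_eq_square)
    also have "\<dots> \<le> (\<Sum>i\<in>(UNIV :: 'n set). 1)"
    proof (intro sum_mono)
      fix i
      have "\<bar>w $ i\<bar> \<le> 1" using w(2)[of i] s01[of i] by auto
      then show "(w $ i)\<^sup>2 \<le> 1" by (simp add: abs_square_le_1)
    qed
    finally show ?thesis by simp
  qed
  then have nw: "norm w \<le> sqrt (real CARD('n))" by (simp add: real_le_rsqrt)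
  have "?e \<bullet> d = ?e \<bullet> w - \<gamma> * (?e \<bullet> (L *v ?e))"
    by (simp add: w(1) inner_diff_right laplacian_disagreement)
  moreover have "?e \<bullet> w \<le> norm ?e * sqrt (real CARD('n))"
    using norm_cauchy_schwarz[of ?e w] mult_left_mono[OF nw, of "norm ?e"] by simp
  moreover have "\<gamma> * (lambda2 L * (norm ?e)\<^sup>2) \<le> \<gamma> * (?e \<bullet> (L *v ?e))"
    unfolding power2_norm_eq_inner
    using \<gamma>_pos by (intro mult_left_mono lambda2_laplacian[OF N2 adj01 adj_sym conn] sum_disagreement) auto
  ultimately show ?thesis by (simp add: power2_eq_square algebra_simps)
qed

section \<open>Long-time behaviour of a given Filippov solution\<close>

context
  fixes x0 :: "real^'n" and x :: "real \<Rightarrow> real^'n"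
  assumes sol: "filippov_solution F x0 x"
begin

lemma solution_abs_cont: "T \<ge> 0 \<Longrightarrow> abs_cont_on {0..T} x"
  using sol by (simp add: filippov_solution_def)

lemma solution_derivative:
  "AE t in lebesgue. t \<ge> 0 \<longrightarrow> (\<exists>d. (x has_vector_derivative d) (at t) \<and> d \<in> filippov_set F (x t))"
  using sol by (simp add: filippov_solution_def)

text \<open>The norm is not differentiable at 0, but derivatives are needed only above the positive
  level radius + e. There the excess e yields the decay rate \<gamma> \<lambda>2 e.\<close>

lemma eventually_disagreement_le:
  assumes e: "e > 0"
  shows "\<forall>\<^sub>F t in at_top. norm (disagreement (x t)) \<le> radius + e"
proof (rule abs_cont_on_eventually_le)
  show "\<gamma> * lambda2 L * e > 0" using \<gamma>_pos lambda2_pos e by simp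
  show "abs_cont_on {0..T} (\<lambda>t. norm (disagreement (x t)))" if "T \<ge> 0" for T
    by (rule abs_cont_on_lipschitz_compose[OF abs_cont_on_linear_compose[OF solution_abs_cont[OF that] linear_disagreement], where C = 1])
       (simp add: norm_triangle_ineq3)
  show "AE t in lebesgue. 0 < t \<and> radius + e < norm (disagreement (x t)) \<longrightarrow>
      (\<exists>d. ((\<lambda>t. norm (disagreement (x t))) has_real_derivative d) (at t) \<and> d \<le> - (\<gamma> * lambda2 L * e))"
    using solution_derivative
  proof eventually_elim
    case (elim t)
    show ?case
    proof (intro impI; elim conjE)
      assume t: "0 < t" "radius + e < norm (disagreement (x t))"
      obtain d where d: "(x has_vector_derivative d) (at t)" "d \<in> filippov_set F (x t)"
        using elim t by auto
      let ?e = "disagreement (x t)"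
      have r: "radius \<ge> 0" using \<gamma>_pos lambda2_pos by (simp add: radius_def)
      then have ne: "norm ?e > 0" using t e by linarith
      have D: "((\<lambda>t. disagreement (x t)) has_vector_derivative disagreement d) (at t)"
        using bounded_linear.has_vector_derivative[OF _ d(1)] linear_disagreement by (simp add: linear_conv_bounded_linear)
      have "((\<lambda>t. norm (disagreement (x t))) has_real_derivative (sgn ?e \<bullet> disagreement d)) (at t)"
        using has_derivative_compose[OF D[unfolded has_vector_derivative_def] has_derivative_norm] ne
        by (simp add: has_field_derivative_def inner_commute mult_commute_abs)
      moreover have "sgn ?e \<bullet> disagreement d \<le> - (\<gamma> * lambda2 L * e)"
      proof -
        have "sgn ?e \<bullet> disagreement d = (?e \<bullet> d) / norm ?e"
          by (simp add: sgn_div_norm inner_disagreement divide_inverse_commute)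
        also have "\<dots> \<le> sqrt (real CARD('n)) - \<gamma> * lambda2 L * norm ?e"
          using disagreement_decay[OF d(2)] ne by (simp add: field_simps)
        also have "\<dots> \<le> sqrt (real CARD('n)) - \<gamma> * lambda2 L * (radius + e)"
          using t \<gamma>_pos lambda2_pos by (intro diff_left_mono mult_left_mono) auto
        also have "\<dots> = - (\<gamma> * lambda2 L * e)"
          using \<gamma>_pos lambda2_pos by (simp add: radius_def distrib_left)
        finally show ?thesis .
      qed
      ultimately show "\<exists>d. ((\<lambda>t. norm (disagreement (x t))) has_real_derivative d) (at t) \<and> d \<le> - (\<gamma> * lambda2 L * e)"
        by blast
    qed
  qed
qed simp

lemma mean_derivative:
  assumes "(x has_vector_derivative d) (at t)"
  shows "((\<lambda>t. mean (x t)) has_real_derivative mean d) (at t)"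
  using bounded_linear.has_vector_derivative[OF _ assms, of mean] linear_mean
  by (simp add: linear_conv_bounded_linear has_real_derivative_iff_has_vector_derivative)

lemma coord_near_mean: "norm (disagreement v) \<le> R \<Longrightarrow> \<bar>v $ i - mean v\<bar> \<le> R"
  using component_le_norm_cart[of "disagreement v" i] by (simp add: disagreement_def)

lemma mean_velocity: "mean (w - \<gamma> *\<^sub>R (L *v v)) = (\<Sum>i\<in>UNIV. w $ i) / real CARD('n)"
  by (simp add: mean_def sum_subtractf sum_laplacian flip: sum_distrib_left)

lemma sum_active:
  assumes "\<And>i. \<bar>w $ i\<bar> \<le> s i"
  shows "(\<Sum>i\<in>UNIV. w $ i) = (\<Sum>i\<in>{i. s i = 1}. w $ i)"
proof (rule sum.mono_neutral_right)
  show "\<forall>i\<in>UNIV - {i. s i = 1}. w $ i = 0"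
  proof
    fix i assume "i \<in> UNIV - {i. s i = 1}"
    then have "s i = 0" using s01[of i] by auto
    then show "w $ i = 0" using assms[of i] by simp
  qed
qed auto

lemma eventually_mean_le:
  assumes e: "e > 0" and maj: "card {i. s i = 1} < 2 * card {i. s i = 1 \<and> z i \<le> hi}"
  shows "\<forall>\<^sub>F t in at_top. mean (x t) \<le> hi + (radius + e)"
proof -
  obtain t0 where t0: "\<And>t. t \<ge> t0 \<Longrightarrow> norm (disagreement (x t)) \<le> radius + e"
    using eventually_disagreement_le[OF e] by (auto simp: eventually_at_top_linorder)
  show ?thesis
  proof (rule abs_cont_on_eventually_le)
    show "abs_cont_on {0..T} (\<lambda>t. mean (x t))" if "T \<ge> 0" for T
      by (rule abs_cont_on_linear_compose[OF solution_abs_cont[OF that] linear_mean])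
    show "1 / real CARD('n) > 0" by simp
    show "max 0 t0 \<ge> 0" by simp
    show "AE t in lebesgue. max 0 t0 < t \<and> hi + (radius + e) < mean (x t) \<longrightarrow>
        (\<exists>d. ((\<lambda>t. mean (x t)) has_real_derivative d) (at t) \<and> d \<le> - (1 / real CARD('n)))"
      using solution_derivative
    proof eventually_elim
      case (elim t)
      show ?case
      proof (intro impI; elim conjE)
        assume t: "max 0 t0 < t" "hi + (radius + e) < mean (x t)"
        obtain d where d: "(x has_vector_derivative d) (at t)" "d \<in> filippov_set F (x t)"
          using elim t by auto
        obtain w where w: "d = w - \<gamma> *\<^sub>R (L *v x t)" "\<And>i. \<bar>w $ i\<bar> \<le> s i" "\<And>i. z i < x t $ i \<Longrightarrow> w $ i = - s i"
          by (rule velocity[OF d(2)]) blast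
        \<comment> \<open>Every coordinate is within radius + e of the mean after t0, so the margin
          put on the mean becomes a strict bound for all coordinates at once.\<close>
        have above: "hi < x t $ i" for i
          using coord_near_mean[OF t0, of t i] t by simp
        have "(\<Sum>i\<in>{i. s i = 1}. w $ i) \<le> -1"
        proof (rule sum_majority_le[OF _ _ maj])
          show "w $ i \<le> 1" if "i \<in> {i. s i = 1}" for i using w(2)[of i] that by simp
          show "w $ i = - 1" if "i \<in> {i. s i = 1 \<and> z i \<le> hi}" for i
            using w(3)[of i] above[of i] that by simp
        qed auto
        then have "mean d \<le> - (1 / real CARD('n))"
          unfolding w(1) mean_velocity sum_active[OF w(2)] by (simp add: divide_simps)
        then show "\<exists>d. ((\<lambda>t. mean (x t)) has_real_derivative d) (at t) \<and> d \<le> - (1 / real CARD('n))"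
          using mean_derivative[OF d(1)] by blast
      qed
    qed
  qed
qed

text \<open>The barrier lemma gives upper bounds only, so it is applied to the negated mean.\<close>

lemma eventually_mean_ge:
  assumes e: "e > 0" and maj: "card {i. s i = 1} < 2 * card {i. s i = 1 \<and> lo \<le> z i}"
  shows "\<forall>\<^sub>F t in at_top. - mean (x t) \<le> - (lo - (radius + e))"
proof -
  obtain t0 where t0: "\<And>t. t \<ge> t0 \<Longrightarrow> norm (disagreement (x t)) \<le> radius + e"
    using eventually_disagreement_le[OF e] by (auto simp: eventually_at_top_linorder)
  show ?thesis
  proof (rule abs_cont_on_eventually_le)
    show "abs_cont_on {0..T} (\<lambda>t. - mean (x t))" if "T \<ge> 0" for T
      by (rule abs_cont_on_linear_compose[OF solution_abs_cont[OF that] linear_compose_neg[OF linear_mean]])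
    show "1 / real CARD('n) > 0" by simp
    show "max 0 t0 \<ge> 0" by simp
    show "AE t in lebesgue. max 0 t0 < t \<and> - (lo - (radius + e)) < - mean (x t) \<longrightarrow>
        (\<exists>d. ((\<lambda>t. - mean (x t)) has_real_derivative d) (at t) \<and> d \<le> - (1 / real CARD('n)))"
      using solution_derivative
    proof eventually_elim
      case (elim t)
      show ?case
      proof (intro impI; elim conjE)
        assume t: "max 0 t0 < t" "- (lo - (radius + e)) < - mean (x t)"
        obtain d where d: "(x has_vector_derivative d) (at t)" "d \<in> filippov_set F (x t)"
          using elim t by auto
        obtain w where w: "d = w - \<gamma> *\<^sub>R (L *v x t)" "\<And>i. \<bar>w $ i\<bar> \<le> s i" "\<And>i. x t $ i < z i \<Longrightarrow> w $ i = s i"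
          by (rule velocity[OF d(2)]) blast
        have below: "x t $ i < lo" for i
          using coord_near_mean[OF t0, of t i] t by simp
        have "(\<Sum>i\<in>{i. s i = 1}. - w $ i) \<le> -1"
        proof (rule sum_majority_le[OF _ _ maj])
          show "- w $ i \<le> 1" if "i \<in> {i. s i = 1}" for i using w(2)[of i] that by simp
          show "- w $ i = - 1" if "i \<in> {i. s i = 1 \<and> lo \<le> z i}" for i
            using w(3)[of i] below[of i] that by simp
        qed auto
        then have "- mean d \<le> - (1 / real CARD('n))"
          unfolding w(1) mean_velocity sum_active[OF w(2)] by (simp add: sum_negf divide_simps)
        then show "\<exists>d. ((\<lambda>t. - mean (x t)) has_real_derivative d) (at t) \<and> d \<le> - (1 / real CARD('n))"
          using DERIV_minus[OF mean_derivative[OF d(1)]] by blast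
      qed
    qed
  qed
qed

lemma limsup_distance_le:
  "Limsup at_top (\<lambda>t. ereal (infdist (x t $ i) (median_set z s))) \<le> ereal (2 * radius)"
proof (rule ereal_le_epsilon2)
  fix e :: real assume e: "0 < e"
  obtain lo hi where M: "lo \<le> hi" "median_set z s = {lo..hi}"
    "card {i. s i = 1} < 2 * card {i. s i = 1 \<and> z i \<le> hi}"
    "card {i. s i = 1} < 2 * card {i. s i = 1 \<and> lo \<le> z i}"
    by (rule median_set_interval[OF s_some])
  \<comment> \<open>Half of e is spent on the mean and half on the disagreement.\<close>
  have e2: "e / 2 > 0" using e by simp
  have "\<forall>\<^sub>F t in at_top. ereal (infdist (x t $ i) (median_set z s)) \<le> ereal (2 * radius + e)"
    using eventually_disagreement_le[OF e2] eventually_mean_le[OF e2 M(3)] eventually_mean_ge[OF e2 M(4)]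
  proof eventually_elim
    case (elim t)
    define p where "p = max lo (min hi (x t $ i))"
    have "p \<in> median_set z s" using M(1,2) by (auto simp: p_def)
    then have "infdist (x t $ i) (median_set z s) \<le> dist (x t $ i) p" by (rule infdist_le)
    also have "\<dots> \<le> 2 * radius + e"
      using coord_near_mean[OF elim(1), of i] elim(2,3) M(1) e e2
      by (auto simp: p_def dist_real_def max_def min_def abs_le_iff)
    finally show ?case by simp
  qed
  then have "Limsup at_top (\<lambda>t. ereal (infdist (x t $ i) (median_set z s))) \<le> ereal (2 * radius + e)"
    by (rule Limsup_bounded)
  then show "Limsup at_top (\<lambda>t. ereal (infdist (x t $ i) (median_set z s))) \<le> ereal (2 * radius) + ereal e"
    by simp
qed

end

text \<open>The value of the field at y is the midpoint of its values at y + u and y - u for small u, and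
  almost every u avoids a given null set on both sides; so sgn(0) = 0 is consistent with
  Filippov's regularization.\<close>
lemma field_in_regularization:
  assumes \<delta>: "\<delta> > 0" and S: "S \<in> null_sets lebesgue"
  shows "F y \<in> closure (convex hull (F ` (ball y \<delta> - S)))"
proof -
  \<comment> \<open>Chosen so that moving by u or -u crosses no switching surface z i = y i on which
    y does not already lie; including \<delta> keeps both points in the ball.\<close>
  define \<eta> where "\<eta> = Min (insert \<delta> ((\<lambda>i. \<bar>z i - y $ i\<bar>) ` {i. z i \<noteq> y $ i}))"
  have \<eta>: "\<eta> > 0" "\<eta> \<le> \<delta>" "\<And>i. z i \<noteq> y $ i \<Longrightarrow> \<eta> \<le> \<bar>z i - y $ i\<bar>"
    using \<delta> by (auto simp: \<eta>_def)
  have negS: "negligible S" using S by (simp add: negligible_iff_null_sets)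
  have "negligible ((\<lambda>v. v - y) ` S \<union> (\<lambda>v. y - v) ` S)"
    using negS by (intro negligible_Un negligible_differentiable_image_negligible
      differentiable_on_diff differentiable_on_ident differentiable_on_const) auto
  moreover have "\<not> negligible (ball (0 :: real^'n) \<eta>)"
    using \<eta>(1) open_not_negligible[of "ball (0 :: real^'n) \<eta>"] by auto
  ultimately have "\<not> ball 0 \<eta> \<subseteq> (\<lambda>v. v - y) ` S \<union> (\<lambda>v. y - v) ` S"
    using negligible_subset by blast
  then obtain u where u: "u \<in> ball 0 \<eta>" "u \<notin> (\<lambda>v. v - y) ` S" "u \<notin> (\<lambda>v. y - v) ` S"
    by blast
  have "y + u \<notin> S" using u(2) by (force simp: image_iff)
  moreover have "y - u \<notin> S" using u(3) by (force simp: image_iff)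
  moreover have "y + u \<in> ball y \<delta>" "y - u \<in> ball y \<delta>" using u(1) \<eta>(2) by (auto simp: dist_norm)
  ultimately have mem: "F (y + u) \<in> F ` (ball y \<delta> - S)" "F (y - u) \<in> F ` (ball y \<delta> - S)" by auto
  have sg: "sgn (z i - (y + u) $ i) + sgn (z i - (y - u) $ i) = 2 * sgn (z i - y $ i)" for i
  proof -
    have ui: "\<bar>u $ i\<bar> < \<eta>" using component_le_norm_cart[of u i] u(1) by simp
    show ?thesis
    proof (cases "z i = y $ i")
      case True
      then show ?thesis by (simp add: sgn_minus)
    next
      case False
      then show ?thesis using \<eta>(3)[OF False] ui by (auto simp: sgn_real_def)
    qed
  qed
  have "F y = (1 / 2) *\<^sub>R F (y + u) + (1 / 2) *\<^sub>R F (y - u)"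
  proof -
    have "F (y + u) $ i + F (y - u) $ i = 2 * F y $ i" for i
    proof -
      have "F (y + u) $ i + F (y - u) $ i
          = s i * (sgn (z i - (y + u) $ i) + sgn (z i - (y - u) $ i)) - \<gamma> * ((L *v (y + u)) $ i + (L *v (y - u)) $ i)"
        unfolding field_eq by (simp add: algebra_simps)
      also have "\<dots> = 2 * F y $ i"
        unfolding sg by (simp add: field_eq matrix_vector_right_distrib matrix_vector_mult_diff_distrib algebra_simps)
      finally show ?thesis .
    qed
    then show ?thesis by (simp add: vec_eq_iff field_simps)
  qed
  also have "\<dots> \<in> convex hull (F ` (ball y \<delta> - S))"
    by (rule convexD[OF convex_convex_hull]) (use mem in \<open>auto intro: hull_inc\<close>)
  finally show ?thesis using closure_subset by blast
qed

text \<open>Each sgn (z i - x i) is nonincreasing in x i and the Laplacian is positive semidefinite.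
  The jumps thus go in the favourable direction, which allows the Euler construction despite the
  discontinuity.\<close>

lemma field_dissipative: "(x - y) \<bullet> (F x - F y) \<le> 0"
proof -
  define p where "p x = (\<chi> i. s i * sgn (z i - x $ i))" for x :: "real^'n"
  have "F x - F y = (p x - p y) - \<gamma> *\<^sub>R (L *v (x - y))"
    unfolding field_eq p_def[symmetric] by (simp add: matrix_vector_mult_diff_distrib algebra_simps)
  then have eq: "(x - y) \<bullet> (F x - F y) = (x - y) \<bullet> (p x - p y) - \<gamma> * ((x - y) \<bullet> (L *v (x - y)))"
    by (simp add: inner_diff_right)
  have "(x - y) \<bullet> (p x - p y) \<le> 0"
    unfolding inner_vec_def
  proof (rule sum_nonpos)
    fix i
    have "(x $ i - y $ i) * (sgn (z i - x $ i) - sgn (z i - y $ i)) \<le> 0"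
      by (cases "x $ i" "y $ i" rule: linorder_cases)
         (auto simp: sgn_real_def mult_le_0_iff)
    then show "(x - y) $ i \<bullet> (p x - p y) $ i \<le> 0"
      using s01[of i] by (auto simp: p_def)
  qed
  moreover have "0 \<le> (x - y) \<bullet> (L *v (x - y))"
  proof -
    have "0 \<le> (\<Sum>i\<in>UNIV. \<Sum>j\<in>UNIV. \<alpha> i j * ((x - y) $ i - (x - y) $ j)\<^sup>2)"
    proof (intro sum_nonneg mult_nonneg_nonneg)
      show "0 \<le> \<alpha> i j" for i j using adj01[of i j] by auto
    qed simp
    then show ?thesis using laplacian_quadratic_form[of \<alpha> "x - y", OF adj_sym] by simp
  qed
  ultimately show ?thesis using \<gamma>_pos by (simp add: eq mult_nonneg_nonneg add_nonpos_nonpos diff_le_0_iff_le order_trans)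
qed

lemma field_growth: "\<exists>K. \<forall>x. norm (F x) \<le> K * (1 + norm x)"
proof -
  obtain C where C: "\<And>x. norm (L *v x) \<le> C * norm x"
    using linear_bounded[OF matrix_vector_mul_linear] by blast
  define K where "K = real CARD('n) + \<gamma> * \<bar>C\<bar>"
  have "norm (F x) \<le> K * (1 + norm x)" for x
  proof -
    have "norm (\<chi> i. s i * sgn (z i - x $ i)) \<le> (\<Sum>i\<in>UNIV. \<bar>s i * sgn (z i - x $ i)\<bar>)"
      using norm_le_l1_cart[of "\<chi> i. s i * sgn (z i - x $ i)"] by simp
    also have "\<dots> \<le> (\<Sum>i\<in>(UNIV :: 'n set). 1)"
    proof (rule sum_mono)
      fix i show "\<bar>s i * sgn (z i - x $ i)\<bar> \<le> 1" using s01[of i] by (auto simp: sgn_real_def)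
    qed
    finally have 1: "norm (\<chi> i. s i * sgn (z i - x $ i)) \<le> real CARD('n)" by simp
    have 2: "norm (\<gamma> *\<^sub>R (L *v x)) \<le> \<gamma> * (\<bar>C\<bar> * norm x)"
      using \<gamma>_pos order_trans[OF C[of x] mult_right_mono[OF abs_ge_self norm_ge_zero]] by simp
    have "norm (F x) \<le> real CARD('n) + \<gamma> * (\<bar>C\<bar> * norm x)"
      unfolding field_eq using norm_triangle_ineq4 1 2 by (meson add_mono order_trans)
    also have "\<dots> \<le> K * (1 + norm x)" using \<gamma>_pos by (simp add: K_def algebra_simps)
    finally show ?thesis .
  qed
  then show ?thesis by blast
qed

lemma solution_exists: "\<exists>x. filippov_solution F x0 x"
proof -
  obtain K where "\<And>x. norm (F x) \<le> K * (1 + norm x)" using field_growth by blast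
  from dissipative_filippov_solution_exists[OF field_dissipative this field_in_regularization]
  show ?thesis .
qed

end

theorem theorem1:
  fixes \<alpha> :: "'n::finite \<Rightarrow> 'n \<Rightarrow> real"
    and z s :: "'n \<Rightarrow> real"
    and \<gamma> :: real
  assumes N2: "CARD('n) \<ge> 2"
    and adj01: "\<And>i j. \<alpha> i j \<in> {0, 1}"
    and adj_sym: "\<And>i j. \<alpha> i j = \<alpha> j i"
    and adj_irrefl: "\<And>i. \<alpha> i i = 0"
    and conn: "graph_connected \<alpha>"
    and s01: "\<And>i. s i \<in> {0, 1}"
    and s_some: "\<exists>i. s i = 1"
    and \<gamma>_pos: "\<gamma> > 0"
  shows "(\<forall>x0. \<exists>x. filippov_solution (median_field \<alpha> z s \<gamma>) x0 x) \<and>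
         (\<forall>x0 x. filippov_solution (median_field \<alpha> z s \<gamma>) x0 x \<longrightarrow>
            (\<forall>i. Limsup at_top (\<lambda>t. ereal (infdist (x t $ i) (median_set z s)))
                   \<le> ereal (2 * sqrt (real CARD('n)) / (\<gamma> * lambda2 (laplacian \<alpha>)))))"
proof -
  interpret median_consensus \<alpha> z s \<gamma>
    by unfold_locales fact+
  have "2 * radius = 2 * sqrt (real CARD('n)) / (\<gamma> * lambda2 (laplacian \<alpha>))"
    by (simp add: radius_def)
  then show ?thesis using solution_exists limsup_distance_le by metis
qed

end
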